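(* Let $G$ be a simple plane graph on $n\geq 5$ vertices with minimum degree $\delta(G)\geq 3$ that contains neither $K_4$ nor $C_5$ as a subgraph. Then $e(G)\leq \frac{15}{7}(n-2)$.
   Context: $K_4$ is the complete graph on $4$ vertices, $C_5$ the cycle on $5$ vertices; $e(G)$ is the number of edges of $G$. "Contains as a subgraph" means not necessarily induced. *)

theory Defs
  imports "HOL-Analysis.Analysis"
begin

definition simple_graph :: "'a set \<Rightarrow> 'a set set \<Rightarrow> bool" where
  "simple_graph V E \<longleftrightarrow> finite V \<and> (\<forall>e\<in>E. e \<subseteq> V \<and> card e = 2)"

definition degree :: "'a set set \<Rightarrow> 'a \<Rightarrow> nat" where
  "degree E v = card {e\<in>E. v \<in> e}"

definition plane_embedding :: "'a set \<Rightarrow> 'a set set \<Rightarrow> ('a \<Rightarrow> complex) \<Rightarrow> ('a set \<Rightarrow> real \<Rightarrow> complex) \<Rightarrow> bool" where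
  "plane_embedding V E f \<gamma> \<longleftrightarrow>
     inj_on f V \<and>
     (\<forall>e\<in>E. arc (\<gamma> e) \<and> {pathstart (\<gamma> e), pathfinish (\<gamma> e)} = f ` e
            \<and> path_image (\<gamma> e) \<inter> f ` V = f ` e) \<and>
     (\<forall>e\<in>E. \<forall>e'\<in>E. e \<noteq> e' \<longrightarrow> path_image (\<gamma> e) \<inter> path_image (\<gamma> e') \<subseteq> f ` (e \<inter> e'))"

definition planar :: "'a set \<Rightarrow> 'a set set \<Rightarrow> bool" where
  "planar V E \<longleftrightarrow> (\<exists>f \<gamma>. plane_embedding V E f \<gamma>)"

definition contains_K4 :: "'a set \<Rightarrow> 'a set set \<Rightarrow> bool" where
  "contains_K4 V E \<longleftrightarrow> (\<exists>a b c d. a \<in> V \<and> b \<in> V \<and> c \<in> V \<and> d \<in> V \<and>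
     distinct [a, b, c, d] \<and>
     {a,b} \<in> E \<and> {a,c} \<in> E \<and> {a,d} \<in> E \<and> {b,c} \<in> E \<and> {b,d} \<in> E \<and> {c,d} \<in> E)"

definition contains_C5 :: "'a set \<Rightarrow> 'a set set \<Rightarrow> bool" where
  "contains_C5 V E \<longleftrightarrow> (\<exists>a b c d x. a \<in> V \<and> b \<in> V \<and> c \<in> V \<and> d \<in> V \<and> x \<in> V \<and>
     distinct [a, b, c, d, x] \<and>
     {a,b} \<in> E \<and> {b,c} \<in> E \<and> {c,d} \<in> E \<and> {d,x} \<in> E \<and> {x,a} \<in> E)"

end

theory Submission
  imports Defs
begin

text \<open>
  Fix the points off the drawing of \<open>G\<close> and, for every edge set \<open>H\<close>, call two of them equivalent
  if they are connected in the complement of the drawing of \<open>H\<close>. By the Jordan curve theorem, adding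
  to \<open>H\<close> an edge that closes a cycle splits a class; by Janiszewski's theorem it splits it into at
  most two parts, and adding a bridge splits nothing. This yields at least \<open>e - n + 2\<close> faces, and it
  shows that the edges separating a face from the others form a bridgeless graph, which is a single
  cycle if it has at most five edges. So face lengths are 3, 4 or at least 6.

  Suppose that \<open>\<delta> \<ge> 3\<close> and that there is no cut vertex. Then two faces never share two consecutive
  edges. Hence a triangular face is adjacent to no 4-face (this would give \<open>C\<^sub>5\<close>) and to at most one
  other triangular face (two would give \<open>C\<^sub>5\<close> or \<open>K\<^sub>4\<close>). Double counting gives \<open>15 f \<le> 8 e\<close>, and
  Euler's inequality turns this into \<open>7 e \<le> 15 (n - 2)\<close>.

  In general \<open>7 e \<le> 15 n - 23\<close> holds for all \<open>n \<ge> 2\<close> without a degree condition, by deleting vertices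
  of degree at most 2 and splitting at cut vertices. If \<open>G\<close> has a cut vertex, adding this bound for
  the two parts even gives \<open>7 e \<le> 15 n - 31\<close>.
\<close>

section \<open>Reachability and paths\<close>

text \<open>No vertex set enters, so deleting a vertex \<open>b\<close> amounts to passing to the
  edges that avoid \<open>b\<close>.\<close>

definition reach :: "'a set set \<Rightarrow> ('a \<times> 'a) set" where
  "reach H = {(u, v). {u, v} \<in> H}\<^sup>*"

lemma reach_refl [simp]: "(a, a) \<in> reach H"
  by (simp add: reach_def)

lemma reach_trans: "(a, b) \<in> reach H \<Longrightarrow> (b, c) \<in> reach H \<Longrightarrow> (a, c) \<in> reach H"
  unfolding reach_def by (rule rtrancl_trans)

lemma reach_edge: "{a, b} \<in> H \<Longrightarrow> (a, b) \<in> reach H"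
  unfolding reach_def by auto

lemma reach_sym: "(a, b) \<in> reach H \<Longrightarrow> (b, a) \<in> reach H"
proof -
  have "sym {(u, v). {u, v} \<in> H}"
    by (auto simp: sym_def insert_commute)
  then show "(a, b) \<in> reach H \<Longrightarrow> (b, a) \<in> reach H"
    unfolding reach_def using sym_rtrancl symD by metis
qed

lemma reach_mono: "H \<subseteq> H' \<Longrightarrow> reach H \<subseteq> reach H'"
  unfolding reach_def by (intro rtrancl_mono) auto

fun path_edges :: "'a list \<Rightarrow> 'a set set" where
  "path_edges (u # v # p) = insert {u, v} (path_edges (v # p))"
| "path_edges p = {}"

lemma path_edges_subset: "e \<in> path_edges p \<Longrightarrow> e \<subseteq> set p"
  by (induction p rule: path_edges.induct) auto

lemma finite_path_edges: "finite (path_edges p)"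
  by (induction p rule: path_edges.induct) auto

lemma path_edges_suffix: "path_edges p \<subseteq> path_edges (q @ p)"
proof (induction q)
  case (Cons u q)
  have "path_edges r \<subseteq> path_edges (u # r)" for r
    by (cases r) auto
  with Cons show ?case by fastforce
qed simp

lemma card_path_edges: "distinct p \<Longrightarrow> card (path_edges p) = length p - 1"
proof (induction p rule: path_edges.induct)
  case (1 u v p)
  then have "{u, v} \<notin> path_edges (v # p)"
    using path_edges_subset by fastforce
  with 1 show ?case by (simp add: finite_path_edges)
qed auto

lemma reach_path_edges: "p \<noteq> [] \<Longrightarrow> (hd p, last p) \<in> reach (path_edges p)"
proof (induction p rule: path_edges.induct)
  case (1 u v p)
  have "(u, v) \<in> reach (path_edges (u # v # p))"
    by (intro reach_edge) simp
  moreover have "(v, last (v # p)) \<in> reach (path_edges (u # v # p))"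
    using 1 reach_mono[of "path_edges (v # p)" "path_edges (u # v # p)"]
    by (simp add: subset_insertI subsetD del: last.simps)
  ultimately show ?case using reach_trans by fastforce
qed auto

text \<open>A new first vertex goes in front of the path built so far or, if it already lies on it,
  the path is cut down to the suffix that starts there.\<close>

lemma reach_distinct_path:
  assumes "(a, b) \<in> reach H"
  obtains p where "distinct p" "p \<noteq> []" "hd p = a" "last p = b" "path_edges p \<subseteq> H"
proof -
  have "\<exists>p. distinct p \<and> p \<noteq> [] \<and> hd p = a \<and> last p = b \<and> path_edges p \<subseteq> H"
    using assms unfolding reach_def
  proof (induction rule: converse_rtrancl_induct)
    case base
    show ?case by (rule exI[of _ "[b]"]) auto
  next
    case (step a c)
    then obtain p where p: "distinct p" "p \<noteq> []" "hd p = c" "last p = b" "path_edges p \<subseteq> H" by blast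
    show ?case
    proof (cases "a \<in> set p")
      case True
      then obtain q r where "p = q @ a # r" by (meson split_list)
      then show ?thesis
        using p path_edges_suffix[of "a # r" q] by (intro exI[of _ "a # r"]) auto
    next
      case False
      then show ?thesis
        using p step.hyps(1) by (intro exI[of _ "a # p"]; cases p) auto
    qed
  qed
  then show ?thesis using that by blast
qed

section \<open>Refinement of equivalence relations\<close>

lemma Image_Image_equiv:
  assumes R: "equiv X R" and S: "equiv X S" and RS: "R \<subseteq> S" and x: "x \<in> X"
  shows "S `` (R `` {x}) = S `` {x}"
proof
  show "S `` (R `` {x}) \<subseteq> S `` {x}"
  proof
    fix y assume "y \<in> S `` (R `` {x})"
    then obtain z where "(x, z) \<in> S" "(z, y) \<in> S" using RS by blast
    then show "y \<in> S `` {x}" using S by (meson ImageI equivE singletonI transD)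
  qed
  show "S `` {x} \<subseteq> S `` (R `` {x})"
    using equiv_class_self[OF R x] by blast
qed

text \<open>Each class of \<open>R\<close> lies in a unique class of \<open>S\<close>, and this
  assignment is onto. If the finite counts agree, it is injective as well, which forces
  \<open>S \<subseteq> R\<close>.\<close>

lemma card_quotient_mono:
  assumes R: "equiv X R" and S: "equiv X S" and RS: "R \<subseteq> S" and fin: "finite (X // R)"
  shows "finite (X // S)" "card (X // S) \<le> card (X // R)"
    "R \<noteq> S \<Longrightarrow> card (X // S) < card (X // R)"
proof -
  note im = Image_Image_equiv[OF R S RS]
  have onto: "X // S = (\<lambda>C. S `` C) ` (X // R)"
    unfolding quotient_def using im by auto
  show "finite (X // S)" "card (X // S) \<le> card (X // R)"
    unfolding onto using fin by (auto intro: card_image_le)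
  show "card (X // S) < card (X // R)" if "R \<noteq> S"
  proof (rule ccontr)
    assume "\<not> card (X // S) < card (X // R)"
    then have inj: "inj_on (\<lambda>C. S `` C) (X // R)"
      using fin onto \<open>card (X // S) \<le> card (X // R)\<close> by (metis eq_card_imp_inj_on le_neq_implies_less)
    have "S \<subseteq> R"
    proof clarify
      fix x y assume xy: "(x, y) \<in> S"
      then have X: "x \<in> X" "y \<in> X" using S unfolding equiv_def by blast+
      have "S `` (R `` {x}) = S `` (R `` {y})"
        using im X xy S by (metis equiv_class_eq_iff)
      then have "R `` {x} = R `` {y}"
        using inj X by (meson inj_onD quotientI)
      then show "(x, y) \<in> R" using R X by (metis eq_equiv_class)
    qed
    with that RS show False by blast
  qed
qed

text \<open>Assumption \<open>two\<close> allows at most two classes of \<open>R\<close> inside one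
  class of \<open>S\<close>. Infinitely many classes of \<open>R\<close> would put three of them
  into the same class of \<open>S\<close>.\<close>

lemma finite_quotient_split:
  assumes R: "equiv X R" and S: "equiv X S" and RS: "R \<subseteq> S" and fin: "finite (X // S)"
    and two: "\<And>x y z. (x, y) \<in> S \<Longrightarrow> (y, z) \<in> S \<Longrightarrow> (x, y) \<in> R \<or> (y, z) \<in> R \<or> (x, z) \<in> R"
  shows "finite (X // R)"
proof (rule ccontr)
  assume inf: "infinite (X // R)"
  note im = Image_Image_equiv[OF R S RS]
  have "(\<lambda>C. S `` C) ` (X // R) \<subseteq> X // S"
    unfolding quotient_def using im by auto
  then have "finite ((\<lambda>C. S `` C) ` (X // R))"
    using fin finite_subset by blast
  then have "\<exists>C0\<in>X // R. infinite {C \<in> X // R. S `` C = S `` C0}"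
    by (rule pigeonhole_infinite[OF inf])
  then obtain C0 where "infinite {C \<in> X // R. S `` C = S `` C0}" ..
  from infinite_arbitrarily_large[OF this, of 3]
  obtain T where T: "T \<subseteq> {C \<in> X // R. S `` C = S `` C0}" "card T = 3"
    by auto
  obtain A B C where ABC: "T = {A, B, C}" "A \<noteq> B" "B \<noteq> C" "A \<noteq> C"
    using T(2) by (auto simp: card_3_iff)
  then have q: "A \<in> X // R" "B \<in> X // R" "C \<in> X // R" "S `` A = S `` B" "S `` B = S `` C"
    using T(1) by auto
  obtain x where x: "x \<in> X" "A = R `` {x}" using q(1) by (rule quotientE)
  obtain y where y: "y \<in> X" "B = R `` {y}" using q(2) by (rule quotientE)
  obtain z where z: "z \<in> X" "C = R `` {z}" using q(3) by (rule quotientE)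
  note xyz = x y z
  have "S `` {x} = S `` {y}" "S `` {y} = S `` {z}"
    using q(4,5) xyz im by simp_all
  then have "(x, y) \<in> S" "(y, z) \<in> S"
    using S xyz by (meson eq_equiv_class)+
  then have "A = B \<or> B = C \<or> A = C"
    using two[of x y z] xyz R by (metis equiv_class_eq)
  with ABC show False by blast
qed

section \<open>Complements of plane drawings\<close>

text \<open>The inverse of the arc would map a nonempty open subset of the plane continuously and
  injectively into the line, against invariance of dimension.\<close>

lemma interior_arc_image:
  fixes g :: "real \<Rightarrow> complex"
  assumes "arc g"
  shows "interior (path_image g) = {}"
proof (rule ccontr)
  assume ne: "interior (path_image g) \<noteq> {}"
  obtain h where h: "homeomorphism {0..1} (path_image g) g h"
    using assms homeomorphism_arc by blast
  have "continuous_on (interior (path_image g)) h"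
    using h interior_subset continuous_on_subset unfolding homeomorphism_def by metis
  moreover have "inj_on h (interior (path_image g))"
    using h interior_subset[of "path_image g"] unfolding homeomorphism_def
    by (intro inj_on_inverseI[of _ g]) blast
  ultimately have "DIM(complex) \<le> DIM(real)"
    using invariance_of_dimension[of "interior (path_image g)" h] ne by blast
  then show False by simp
qed

text \<open>Components of open sets are open, so the points reached from \<open>x\<close> by chains
  and the points not reached both form open sets. A connected subset of \<open>A \<union> B\<close>
  containing \<open>x\<close> lies in the first.\<close>

lemma connected_component_Un_chain:
  fixes A B :: "'a::real_normed_vector set"
  assumes "open A" "open B" and xy: "connected_component (A \<union> B) x y"
  shows "(sup (connected_component A) (connected_component B))\<^sup>*\<^sup>* x y"
proof -
  let ?r = "sup (connected_component A) (connected_component B)"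
  define Z where "Z = {z \<in> A \<union> B. ?r\<^sup>*\<^sup>* x z}"
  have op: "open {z \<in> A \<union> B. P z}"
    if P: "\<And>u v. ?r u v \<Longrightarrow> P u \<Longrightarrow> P v" for P
  proof (subst open_subopen, rule ballI)
    fix z assume z: "z \<in> {z \<in> A \<union> B. P z}"
    then consider "z \<in> A" | "z \<in> B" by blast
    then show "\<exists>T. open T \<and> z \<in> T \<and> T \<subseteq> {z \<in> A \<union> B. P z}"
    proof cases
      case 1
      have "connected_component_set A z \<subseteq> {z \<in> A \<union> B. P z}"
        using P z connected_component_subset by fastforce
      then show ?thesis
        using 1 open_connected_component[OF assms(1)] connected_component_refl_eq
        by (metis mem_Collect_eq)
    next
      case 2
      have "connected_component_set B z \<subseteq> {z \<in> A \<union> B. P z}"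
        using P z connected_component_subset by fastforce
      then show ?thesis
        using 2 open_connected_component[OF assms(2)] connected_component_refl_eq
        by (metis mem_Collect_eq)
    qed
  qed
  have symr: "?r v u" if "?r u v" for u v
    using that by (auto intro: connected_component_sym)
  have oZ: "open Z"
    unfolding Z_def by (rule op) (meson rtranclp.rtrancl_into_rtrancl)
  have oN: "open {z \<in> A \<union> B. \<not> ?r\<^sup>*\<^sup>* x z}"
    by (rule op) (meson rtranclp.rtrancl_into_rtrancl symr)
  obtain C where C: "connected C" "C \<subseteq> A \<union> B" "x \<in> C" "y \<in> C"
    using xy unfolding connected_component_def by blast
  show ?thesis
  proof (rule ccontr)
    assume "\<not> ?thesis"
    then have "\<not> connected C"
      unfolding connected_def using oZ oN C unfolding Z_def by blast
    with C show False by simp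
  qed
qed

section \<open>Plane graphs and the faces of their subgraphs\<close>

locale plane_graph =
  fixes V :: "'a set" and E :: "'a set set"
    and f :: "'a \<Rightarrow> complex" and \<gamma> :: "'a set \<Rightarrow> real \<Rightarrow> complex"
  assumes simple: "simple_graph V E"
    and embedding: "plane_embedding V E f \<gamma>"
begin

text \<open>Every vertex is drawn whatever \<open>H\<close> is, so deleting an edge from
  \<open>H\<close> removes from the drawing just the arc without its ends.\<close>

definition drawing :: "'a set set \<Rightarrow> complex set" where
  "drawing H = f ` V \<union> (\<Union>e\<in>H. path_image (\<gamma> e))"

definition X :: "complex set" where
  "X = - drawing E"

text \<open>The ground set \<open>X\<close> is the same for all \<open>H\<close>, so that these relations can be compared.\<close>

definition same_face :: "'a set set \<Rightarrow> (complex \<times> complex) set" where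
  "same_face H = {(x, y). x \<in> X \<and> y \<in> X \<and> connected_component (- drawing H) x y}"

lemma finite_V: "finite V" and edgeD: "e \<in> E \<Longrightarrow> e \<subseteq> V \<and> card e = 2"
  using simple by (auto simp: simple_graph_def)

lemma finite_E: "finite E"
  using finite_V edgeD by (meson PowI finite_Pow_iff finite_subset subsetI)

lemma arc_edge: "e \<in> E \<Longrightarrow> arc (\<gamma> e)"
  and ends_edge: "e \<in> E \<Longrightarrow> {pathstart (\<gamma> e), pathfinish (\<gamma> e)} = f ` e"
  and edge_Int_V: "e \<in> E \<Longrightarrow> path_image (\<gamma> e) \<inter> f ` V = f ` e"
  and edge_Int_edge: "e \<in> E \<Longrightarrow> e' \<in> E \<Longrightarrow> e \<noteq> e' \<Longrightarrow>
    path_image (\<gamma> e) \<inter> path_image (\<gamma> e') \<subseteq> f ` (e \<inter> e')"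
  and inj_f: "inj_on f V"
  using embedding by (auto simp: plane_embedding_def)

lemma compact_drawing: "H \<subseteq> E \<Longrightarrow> compact (drawing H)"
proof -
  assume H: "H \<subseteq> E"
  have "compact (f ` V)" using finite_V by (simp add: finite_imp_compact)
  moreover have "compact (\<Union>e\<in>H. path_image (\<gamma> e))"
    using H finite_subset[OF H finite_E] by (intro compact_UN compact_arc_image arc_edge) auto
  ultimately show ?thesis unfolding drawing_def by (rule compact_Un)
qed

lemma closed_drawing: "H \<subseteq> E \<Longrightarrow> closed (drawing H)"
  by (simp add: compact_drawing compact_imp_closed)

lemma drawing_mono: "H \<subseteq> H' \<Longrightarrow> drawing H \<subseteq> drawing H'"
  by (auto simp: drawing_def)

lemma V_subset_drawing: "f ` V \<subseteq> drawing H"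
  by (auto simp: drawing_def)

lemma edge_subset_drawing: "e \<in> H \<Longrightarrow> path_image (\<gamma> e) \<subseteq> drawing H"
  by (auto simp: drawing_def)

lemma drawing_insert: "e \<in> H \<Longrightarrow> drawing H = path_image (\<gamma> e) \<union> drawing (H - {e})"
  by (auto simp: drawing_def)

lemma edge_Int_drawing:
  assumes "e \<in> E" "H \<subseteq> E"
  shows "path_image (\<gamma> e) \<inter> drawing (H - {e}) = f ` e"
proof
  show "path_image (\<gamma> e) \<inter> drawing (H - {e}) \<subseteq> f ` e"
    using edge_Int_V[OF assms(1)] edge_Int_edge[OF assms(1)] assms(2)
    unfolding drawing_def by blast
  show "f ` e \<subseteq> path_image (\<gamma> e) \<inter> drawing (H - {e})"
    using edge_Int_V[OF assms(1)] by (auto simp: drawing_def)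
qed

text \<open>Distinct edges meet only in vertices, and vertices belong to every drawing. In terms of
  complements, an intersection of edge sets becomes a union of two open sets.\<close>

lemma drawing_Int:
  assumes "H \<subseteq> E" "H' \<subseteq> E"
  shows "drawing (H \<inter> H') = drawing H \<inter> drawing H'"
proof
  show "drawing H \<inter> drawing H' \<subseteq> drawing (H \<inter> H')"
  proof
    fix x assume x: "x \<in> drawing H \<inter> drawing H'"
    show "x \<in> drawing (H \<inter> H')"
    proof (cases "x \<in> f ` V")
      case False
      then obtain e e' where e: "e \<in> H" "x \<in> path_image (\<gamma> e)" "e' \<in> H'" "x \<in> path_image (\<gamma> e')"
        using x by (auto simp: drawing_def)
      have "e = e'"
      proof (rule ccontr)
        assume "e \<noteq> e'"
        then have "x \<in> f ` (e \<inter> e')"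
          using edge_Int_edge[of e e'] e assms by blast
        then show False
          using False edgeD[of e] e assms by blast
      qed
      then show ?thesis using e by (auto simp: drawing_def)
    qed (simp add: drawing_def)
  qed
qed (simp add: drawing_mono)

lemma edge_inner_point:
  assumes "e \<in> E"
  obtains p where "p \<in> path_image (\<gamma> e)" "p \<notin> f ` e"
proof -
  have "\<gamma> e ` {0<..<1} \<noteq> {}" by simp
  then have "path_image (\<gamma> e) - {pathstart (\<gamma> e), pathfinish (\<gamma> e)} \<noteq> {}"
    using simple_path_endless[OF arc_imp_simple_path[OF arc_edge[OF assms]]] by metis
  then show ?thesis
    using that ends_edge[OF assms] by blast
qed

lemma connected_edge_inner:
  assumes "e \<in> E"
  shows "connected (path_image (\<gamma> e) - f ` e)"
  using connected_simple_path_endless[OF arc_imp_simple_path[OF arc_edge[OF assms]]]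
    ends_edge[OF assms] by simp

lemma interior_drawing: "interior (drawing E) = {}"
proof -
  have "interior (f ` V \<union> (\<Union>e\<in>H. path_image (\<gamma> e))) = {}" if "H \<subseteq> E" for H
    using finite_subset[OF that finite_E] that
  proof (induction H rule: finite_induct)
    case empty
    show ?case using finite_V by (simp add: finite_imp_compact empty_interior_finite)
  next
    case (insert e H)
    have "interior (path_image (\<gamma> e) \<union> (f ` V \<union> (\<Union>e\<in>H. path_image (\<gamma> e)))) = interior (path_image (\<gamma> e))"
      using insert arc_edge[of e] by (intro interior_closed_Un_empty_interior closed_arc_image) auto
    also have "\<dots> = {}" using insert arc_edge[of e] interior_arc_image by blast
    finally show ?case by (simp add: Un_ac)
  qed
  then show ?thesis by (simp add: drawing_def)
qed

text \<open>\<open>X\<close> is dense, so every face of every subgraph contains points of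
  \<open>X\<close> and no face is lost in \<open>same_face\<close>.\<close>

lemma open_meets_X:
  assumes "open U" "U \<noteq> {}"
  obtains x where "x \<in> U" "x \<in> X"
  using assms interior_drawing interior_maximal[of U "drawing E"] unfolding X_def by blast

lemma X_nonempty: "X \<noteq> {}"
  using open_meets_X[of UNIV] by auto

lemma equiv_same_face:
  assumes "H \<subseteq> E"
  shows "equiv X (same_face H)"
proof (rule equivI)
  show "refl_on X (same_face H)"
    using drawing_mono[OF assms] by (auto simp: refl_on_def same_face_def X_def)
  show "same_face H \<subseteq> X \<times> X"
    by (auto simp: same_face_def)
  show "sym (same_face H)"
    by (auto simp: sym_def same_face_def intro: connected_component_sym)
  show "trans (same_face H)"
    unfolding trans_def same_face_def by (auto intro: connected_component_trans)
qed

lemma same_face_anti: "H \<subseteq> H' \<Longrightarrow> same_face H' \<subseteq> same_face H"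
  using drawing_mono[of H H'] connected_component_mono[of "- drawing H'" "- drawing H"]
  by (auto simp: same_face_def)

lemma same_face_empty: "same_face {} = X \<times> X"
proof -
  have "connected (- f ` V)"
    using path_connected_complement_countable[of "f ` V"] finite_V
    by (simp add: countable_finite path_connected_imp_connected)
  moreover have "X \<subseteq> - f ` V"
    using V_subset_drawing by (auto simp: X_def)
  ultimately show ?thesis
    unfolding same_face_def drawing_def
    by (auto simp: connected_iff_connected_component)
qed

text \<open>The complement of the drawing of \<open>H \<inter> H'\<close> is the union of the other
  two complements, so a connection in it is a chain of connections in one or the other. The turning
  points of the chain may lie outside \<open>X\<close> and have to be moved into it.\<close>

lemma same_face_Int:
  assumes H: "H \<subseteq> E" "H' \<subseteq> E"
  shows "same_face (H \<inter> H') \<subseteq> (same_face H \<union> same_face H')\<^sup>*"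
proof clarify
  fix x y assume "(x, y) \<in> same_face (H \<inter> H')"
  then have xy: "x \<in> X" "y \<in> X" "connected_component (- drawing H \<union> - drawing H') x y"
    by (auto simp: same_face_def drawing_Int[OF H])
  let ?c = "sup (connected_component (- drawing H)) (connected_component (- drawing H'))"
  have "?c\<^sup>*\<^sup>* x y"
    using closed_drawing H by (intro connected_component_Un_chain xy(3)) (simp_all add: open_Compl)
  \<comment> \<open>Since an intermediate point of the chain may lie outside \<open>X\<close>, the
    induction speaks about all points of \<open>X\<close> at most one step further.\<close>
  then have "\<forall>w\<in>X. ?c\<^sup>=\<^sup>= y w \<longrightarrow> (x, w) \<in> (same_face H \<union> same_face H')\<^sup>*"
  proof (induction rule: rtranclp_induct)
    case base
    then show ?case
      using xy(1) by (auto simp: same_face_def intro!: r_into_rtrancl)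
  next
    case (step u v)
    show ?case
    proof (intro ballI impI)
      fix w assume w: "w \<in> X" "?c\<^sup>=\<^sup>= v w"
      have trans: "connected_component S u w"
        if "connected_component S u v" "connected_component S v w" for S
        using that connected_component_trans by metis
      show "(x, w) \<in> (same_face H \<union> same_face H')\<^sup>*"
      proof (cases "?c\<^sup>=\<^sup>= u w")
        case True
        then show ?thesis using step.IH w by blast
      next
        case False
        \<comment> \<open>The steps to and from \<open>v\<close> do not merge into one, so they use
          different complements and \<open>v\<close> lies in both. A point \<open>v'\<close> of
          \<open>X\<close>, joined to \<open>v\<close> in the intersection of the complements, takes
          its place.\<close>
        then have v: "v \<in> - drawing H" "v \<in> - drawing H'"
          using w(2) step.hyps(2) trans connected_component_in
          by (metis sup2CI sup2E)+
        have "open (- drawing H \<inter> - drawing H')"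
          using closed_drawing H by blast
        then have "open (connected_component_set (- drawing H \<inter> - drawing H') v)"
          by (rule open_connected_component)
        moreover have "v \<in> connected_component_set (- drawing H \<inter> - drawing H') v"
          using v by auto
        ultimately obtain v' where v': "v' \<in> X" "connected_component (- drawing H \<inter> - drawing H') v v'"
          using open_meets_X by (metis empty_iff mem_Collect_eq)
        then have vv: "connected_component (- drawing H) v v'" "connected_component (- drawing H') v v'"
          by (meson connected_component_mono inf_le1 inf_le2 connected_component_of_subset)+
        have "?c u v'"
          using step.hyps(2) vv connected_component_trans by (metis sup2CI sup2E)
        then have "(x, v') \<in> (same_face H \<union> same_face H')\<^sup>*"
          using step.IH v' by blast
        have "?c v w"
          using w(2) False step.hyps(2) by auto
        then have "?c v' w"
          using connected_component_trans[OF connected_component_sym[OF vv(1)]]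
            connected_component_trans[OF connected_component_sym[OF vv(2)]] by auto
        then have "(v', w) \<in> same_face H \<union> same_face H'"
          using v' w by (auto simp: same_face_def)
        with \<open>(x, v') \<in> _\<close> show ?thesis by (rule rtrancl_into_rtrancl)
      qed
    qed
  qed
  then show "(x, y) \<in> (same_face H \<union> same_face H')\<^sup>*"
    using xy by blast
qed

section \<open>The effect of one edge on the faces\<close>

lemma reach_path_component:
  assumes "H \<subseteq> E" "a \<in> V" "(a, b) \<in> reach H"
  shows "path_component (drawing H) (f a) (f b)"
  using assms(3) unfolding reach_def
proof (induction rule: rtrancl_induct)
  case base
  then show ?case using assms(2) V_subset_drawing by (intro path_component_refl) blast
next
  case (step u v)
  then have e: "{u, v} \<in> H" "{u, v} \<in> E" using assms(1) by auto
  have "path_component (path_image (\<gamma> {u, v})) (f u) (f v)"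
    using arc_edge[OF e(2)] edge_Int_V[OF e(2)]
    by (intro path_connected_component[THEN iffD1, rule_format])
       (auto intro: path_connected_path_image arc_imp_path)
  then have "path_component (drawing H) (f u) (f v)"
    using path_component_of_subset edge_subset_drawing[OF e(1)] by blast
  with step.IH show ?case by (rule path_component_trans)
qed

text \<open>A path in the rest of the drawing joins the ends of the edge, and an arc inside its
  image closes the edge up to a Jordan curve. \<open>K\<close> is this arc; its connectedness is
  what Janiszewski's theorem asks for later.\<close>

lemma closed_curve_through_edge:
  assumes H: "H \<subseteq> E" and e: "{a, b} \<in> H" and r: "(a, b) \<in> reach (H - {{a, b}})"
  obtains c K where "simple_path c" "pathfinish c = pathstart c"
    "path_image c = path_image (\<gamma> {a, b}) \<union> K" "connected K" "f ` {a, b} \<subseteq> K"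
    "K \<subseteq> drawing (H - {{a, b}})"
proof -
  let ?e = "{a, b}"
  have eE: "?e \<in> E" and ab: "a \<in> V" "b \<in> V" "a \<noteq> b"
    using H e edgeD[of ?e] by auto
  have fab: "f a \<noteq> f b" using ab inj_f by (auto dest: inj_onD)
  obtain u v where uv: "pathstart (\<gamma> ?e) = u" "pathfinish (\<gamma> ?e) = v" "{u, v} = {f a, f b}"
    using ends_edge[OF eE] by auto
  have "path_component (drawing (H - {?e})) (f a) (f b)"
    using reach_path_component r ab H by blast
  then have "path_component (drawing (H - {?e})) v u"
    using uv(3) path_component_sym by (metis doubleton_eq_iff)
  then obtain p where p: "path p" "path_image p \<subseteq> drawing (H - {?e})" "pathstart p = v" "pathfinish p = u"
    unfolding path_component_def by blast
  have "v \<noteq> u" using uv(3) fab by (metis doubleton_eq_iff)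
  then obtain g where g: "arc g" "path_image g \<subseteq> path_image p" "pathstart g = v" "pathfinish g = u"
    using path_contains_arc[OF p(1,3,4)] by metis
  have "path_image (\<gamma> ?e) \<inter> path_image g \<subseteq> f ` ?e"
    using edge_Int_drawing[OF eE H] g(2) p(2) by blast
  then have "simple_path (\<gamma> ?e +++ g)"
    using uv g arc_edge[OF eE] by (intro simple_path_join_loop) auto
  moreover have "u \<in> path_image g" "v \<in> path_image g"
    using g pathstart_in_path_image pathfinish_in_path_image by metis+
  moreover have "f ` {a, b} \<subseteq> path_image g"
    using uv(3) \<open>u \<in> path_image g\<close> \<open>v \<in> path_image g\<close>
    by (metis empty_subsetI image_empty image_insert insert_subset)
  ultimately show ?thesis
    using that[of "\<gamma> ?e +++ g" "path_image g"] g p uv(1,2)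
    by (simp add: path_image_join connected_arc_image)
qed

text \<open>An inner point \<open>p\<close> of the edge is on the frontier of both sides of the
  Jordan curve. A small ball around \<open>p\<close> misses the rest of the drawing, so it connects
  a point inside the curve with one outside once the edge is gone.\<close>

lemma nonbridge_separates:
  assumes H: "H \<subseteq> E" and e: "{a, b} \<in> H" and r: "(a, b) \<in> reach (H - {{a, b}})"
  shows "\<exists>x y. (x, y) \<in> same_face (H - {{a, b}}) \<and> (x, y) \<notin> same_face H"
proof -
  let ?e = "{a, b}"
  have eE: "?e \<in> E" using H e by blast
  obtain c K where c: "simple_path c" "pathfinish c = pathstart c"
    "path_image c = path_image (\<gamma> ?e) \<union> K" "K \<subseteq> drawing (H - {?e})"
    using closed_curve_through_edge[OF assms] by metis
  obtain inner outer where io: "open inner" "open outer" "inner \<inter> outer = {}"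
      "inner \<union> outer = - path_image c" "frontier inner = path_image c" "frontier outer = path_image c"
    using Jordan_curve[OF c(1,2)] by metis
  obtain p where p: "p \<in> path_image (\<gamma> ?e)" "p \<notin> f ` ?e"
    using edge_inner_point[OF eE] .
  then have "p \<in> - drawing (H - {?e})"
    using edge_Int_drawing[OF eE H] by blast
  moreover have "open (- drawing (H - {?e}))"
    using closed_drawing[of "H - {?e}"] H by blast
  ultimately obtain r where r: "r > 0" "ball p r \<subseteq> - drawing (H - {?e})"
    by (meson openE)
  have meets: "\<exists>x. x \<in> ball p r \<and> x \<in> W \<and> x \<in> X"
    if "open W" "frontier W = path_image c" for W
  proof -
    have "p \<in> closure W" using p c that by (auto simp: frontier_def)
    then have "ball p r \<inter> W \<noteq> {}"
      using r(1) by (meson centre_in_ball disjoint_iff open_Int_closure_eq_empty open_ball)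
    then show ?thesis
      using open_meets_X[of "ball p r \<inter> W"] that(1) by blast
  qed
  obtain x y where x: "x \<in> ball p r" "x \<in> inner" "x \<in> X"
    and y: "y \<in> ball p r" "y \<in> outer" "y \<in> X"
    using meets[OF io(1,5)] meets[OF io(2,6)] by metis
  have "connected_component (- drawing (H - {?e})) x y"
    unfolding connected_component_def
    using r x y by (intro exI[of _ "ball p r"]) auto
  moreover have "\<not> connected_component (- drawing H) x y"
  proof
    assume "connected_component (- drawing H) x y"
    then obtain C where C: "connected C" "C \<subseteq> - drawing H" "x \<in> C" "y \<in> C"
      unfolding connected_component_def by blast
    have "path_image c \<subseteq> drawing H"
      using c(3,4) drawing_insert[OF e] by blast
    then have "C \<subseteq> inner \<union> outer" using C io(4) by blast
    then have "\<not> connected C"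
      unfolding connected_def using io x y C by blast
    with C show False by simp
  qed
  ultimately show ?thesis
    using x y by (auto simp: same_face_def)
qed

text \<open>Two of the three points lie on the same side of the Jordan curve through the edge. The
  curve and the rest of the drawing meet exactly in the connected set \<open>K\<close>, so
  Janiszewski's theorem applies to them.\<close>

lemma nonbridge_two_sides:
  assumes H: "H \<subseteq> E" and e: "{a, b} \<in> H" and r: "(a, b) \<in> reach (H - {{a, b}})"
    and xyz: "(x, y) \<in> same_face (H - {{a, b}})" "(y, z) \<in> same_face (H - {{a, b}})"
  shows "(x, y) \<in> same_face H \<or> (y, z) \<in> same_face H \<or> (x, z) \<in> same_face H"
proof -
  let ?e = "{a, b}"
  have eE: "?e \<in> E" using H e by blast
  obtain c K where c: "simple_path c" "pathfinish c = pathstart c"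
    "path_image c = path_image (\<gamma> ?e) \<union> K" "connected K" "f ` {a, b} \<subseteq> K"
    "K \<subseteq> drawing (H - {?e})"
    using closed_curve_through_edge[OF assms(1-3)] by metis
  obtain inner outer where io: "connected inner" "connected outer" "inner \<union> outer = - path_image c"
    using Jordan_curve[OF c(1,2)] by metis
  have cH: "path_image c \<union> drawing (H - {?e}) = drawing H"
    using c(3,6) drawing_insert[OF e] by blast
  have int: "path_image c \<inter> drawing (H - {?e}) = K"
    using c(3,5,6) edge_Int_drawing[OF eE H] by blast
  have same: "(s, t) \<in> same_face H"
    if st: "(s, t) \<in> same_face (H - {?e})" and W: "connected W" "W \<subseteq> - path_image c" "s \<in> W" "t \<in> W"
    for s t W
  proof -
    have "connected_component (- (path_image c \<union> drawing (H - {?e}))) s t"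
    proof (rule Janiszewski)
      show "compact (path_image c)" using c compact_simple_path_image by blast
      show "closed (drawing (H - {?e}))" using closed_drawing[of "H - {?e}"] H by blast
      show "connected (path_image c \<inter> drawing (H - {?e}))" using int c by simp
      show "connected_component (- path_image c) s t"
        using W unfolding connected_component_def by blast
      show "connected_component (- drawing (H - {?e})) s t" using st by (simp add: same_face_def)
    qed
    then show ?thesis using st unfolding cH by (simp add: same_face_def)
  qed
  have xz: "(x, z) \<in> same_face (H - {?e})"
    using xyz equiv_same_face[of "H - {?e}"] H by (meson Diff_subset equivE order_trans transD)
  have "- path_image c \<supseteq> X" using cH drawing_mono[OF H] by (auto simp: X_def)
  then have "x \<in> inner \<union> outer" "y \<in> inner \<union> outer" "z \<in> inner \<union> outer"
    using xyz io(3) by (auto simp: same_face_def)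
  then show ?thesis
    using same[OF xyz(1), of inner] same[OF xyz(1), of outer] same[OF xyz(2), of inner]
      same[OF xyz(2), of outer] same[OF xz, of inner] same[OF xz, of outer] io by blast
qed

text \<open>Without the bridge the drawing splits into disjoint compact sets, \<open>A\<close>
  carrying the component of \<open>a\<close> and \<open>B\<close> the rest. An arc does not separate
  the plane, and Janiszewski's theorem adds first \<open>A\<close> and then \<open>B\<close> to the
  arc, the intersections being the single points \<open>f a\<close> and \<open>f b\<close>.\<close>

lemma bridge_one_side:
  assumes H: "H \<subseteq> E" and e: "{a, b} \<in> H" and r: "(a, b) \<notin> reach (H - {{a, b}})"
  shows "same_face (H - {{a, b}}) \<subseteq> same_face H"
proof clarify
  fix x y assume xy: "(x, y) \<in> same_face (H - {{a, b}})"
  let ?e = "{a, b}"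
  have eE: "?e \<in> E" and ab: "a \<in> V" "b \<in> V" "a \<noteq> b"
    using H e edgeD[of ?e] by auto
  define VA where "VA = {v \<in> V. (a, v) \<in> reach (H - {?e})}"
  define A where "A = f ` VA \<union> (\<Union>d\<in>{d \<in> H - {?e}. d \<subseteq> VA}. path_image (\<gamma> d))"
  define B where "B = f ` (V - VA) \<union> (\<Union>d\<in>{d \<in> H - {?e}. d \<inter> VA = {}}. path_image (\<gamma> d))"
  have finH: "finite H" using H finite_E finite_subset by blast
  have comp_edges: "compact (\<Union>d\<in>D. path_image (\<gamma> d))" if "D \<subseteq> H" for D
    using that H finite_subset[OF that finH]
    by (intro compact_UN compact_arc_image arc_edge) auto
  have comp: "compact A" "compact B"
    unfolding A_def B_def using finite_V
    by (intro compact_Un comp_edges; force simp: finite_imp_compact VA_def)+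
  have dich: "d \<subseteq> VA \<or> d \<inter> VA = {}" if "d \<in> H - {?e}" for d
  proof -
    have d: "d \<subseteq> V" "card d = 2" using edgeD[of d] that H by auto
    then obtain u v where uv: "d = {u, v}" "u \<in> V" "v \<in> V"
      by (auto simp: card_2_iff)
    then have "(u, v) \<in> reach (H - {?e})" "(v, u) \<in> reach (H - {?e})"
      using that reach_edge reach_sym by metis+
    then have "u \<in> VA \<longleftrightarrow> v \<in> VA"
      using uv(2,3) reach_trans[of a] unfolding VA_def by blast
    then show ?thesis using uv(1) by auto
  qed
  have AB: "A \<union> B = drawing (H - {?e})"
    using dich unfolding A_def B_def drawing_def VA_def by blast
  have dA: "path_image (\<gamma> d) \<inter> f ` V \<subseteq> f ` d" if "d \<in> H" for d
    using edge_Int_V[of d] that H by blast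
  have disj: "A \<inter> B = {}"
  proof -
    have 1: "f ` VA \<inter> f ` (V - VA) = {}"
      using inj_f by (auto simp: VA_def dest: inj_onD)
    have 2: "path_image (\<gamma> d) \<inter> f ` (V - VA) = {}" if "d \<in> H" "d \<subseteq> VA" for d
      using dA[OF that(1)] that(2) 1 by blast
    have 3: "path_image (\<gamma> d) \<inter> f ` VA = {}" if "d \<in> H" "d \<inter> VA = {}" for d
    proof -
      have "d \<subseteq> V - VA" using that edgeD[of d] H by blast
      then have "f ` d \<inter> f ` VA = {}" using 1 by blast
      moreover have "f ` VA \<subseteq> f ` V" by (auto simp: VA_def)
      ultimately show ?thesis using dA[OF that(1)] by blast
    qed
    have 4: "path_image (\<gamma> d) \<inter> path_image (\<gamma> d') = {}"
      if d: "d \<in> H" "d' \<in> H" "d \<subseteq> VA" "d' \<inter> VA = {}" for d d'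
    proof -
      have "d \<inter> d' = {}" using d by blast
      moreover have "d \<noteq> {}" using d edgeD[of d] H by auto
      then have "d \<noteq> d'" using d by blast
      ultimately show ?thesis using edge_Int_edge[of d d'] d H by blast
    qed
    show ?thesis
    proof (rule equals0I)
      fix p assume p: "p \<in> A \<inter> B"
      then have "p \<in> f ` VA \<or> (\<exists>d\<in>H. d \<subseteq> VA \<and> p \<in> path_image (\<gamma> d))"
        by (auto simp: A_def)
      moreover have "p \<in> f ` (V - VA) \<or> (\<exists>d\<in>H. d \<inter> VA = {} \<and> p \<in> path_image (\<gamma> d))"
        using p unfolding B_def by blast
      ultimately show False
        by (elim disjE bexE conjE) (metis 1 2 3 4 IntI empty_iff)+
    qed
  qed
  have a: "f a \<in> A" using ab by (auto simp: A_def VA_def)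
  have b: "f b \<in> B" using ab r by (auto simp: B_def VA_def)
  have eAB: "path_image (\<gamma> ?e) \<inter> (A \<union> B) = {f a, f b}"
    using edge_Int_drawing[OF eE H] AB by simp
  have eA: "path_image (\<gamma> ?e) \<inter> A = {f a}" and eB: "path_image (\<gamma> ?e) \<inter> B = {f b}"
    using eAB a b disj by blast+
  have cc: "connected_component (- (A \<union> B)) x y"
    using xy AB by (simp add: same_face_def)
  then have cA: "connected_component (- A) x y" and cB: "connected_component (- B) x y"
    using connected_component_of_subset by (metis Compl_anti_mono Un_upper1, metis Compl_anti_mono Un_upper2)
  have "x \<in> X" "y \<in> X" using xy by (auto simp: same_face_def)
  then have "x \<in> - path_image (\<gamma> ?e)" "y \<in> - path_image (\<gamma> ?e)"
    using edge_subset_drawing[OF eE] by (auto simp: X_def)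
  then have "connected_component (- path_image (\<gamma> ?e)) x y"
    using connected_arc_complement[OF arc_edge[OF eE]]
    by (simp add: connected_iff_connected_component)
  then have ceA: "connected_component (- (path_image (\<gamma> ?e) \<union> A)) x y"
    using comp eA cA arc_edge[OF eE]
    by (intro Janiszewski) (auto simp: compact_arc_image compact_imp_closed)
  have "connected_component (- (path_image (\<gamma> ?e) \<union> A \<union> B)) x y"
    using comp eB disj arc_edge[OF eE]
    by (intro Janiszewski[OF _ _ _ ceA cB])
       (auto simp: compact_arc_image compact_Un compact_imp_closed Int_Un_distrib2)
  moreover have "path_image (\<gamma> ?e) \<union> A \<union> B = drawing H"
    using AB drawing_insert[OF e] by (simp add: Un_assoc)
  ultimately show "(x, y) \<in> same_face H"
    using xy by (simp add: same_face_def)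
qed

text \<open>Two points that only \<open>e\<close> separates are connected, without \<open>e\<close>,
  to inner points of \<open>e\<close>. These inner points form a connected set, so they lie in a
  single face of \<open>H - {e}\<close>.\<close>

lemma unique_split_face:
  assumes H: "H \<subseteq> E" and e: "e \<in> H"
    and xy: "(x, y) \<in> same_face (H - {e})" "(x, y) \<notin> same_face H"
    and uv: "(u, v) \<in> same_face (H - {e})" "(u, v) \<notin> same_face H"
  shows "(x, u) \<in> same_face (H - {e})"
proof -
  have eE: "e \<in> E" using H e by blast
  let ?I = "path_image (\<gamma> e) - f ` e"
  have I: "connected ?I" "?I \<subseteq> - drawing (H - {e})"
    using connected_edge_inner[OF eE] edge_Int_drawing[OF eE H] by blast+
  have meet: "\<exists>p\<in>?I. connected_component (- drawing (H - {e})) s p"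
    if st: "(s, t) \<in> same_face (H - {e})" "(s, t) \<notin> same_face H" for s t
  proof (rule ccontr)
    assume no: "\<not> ?thesis"
    let ?U = "connected_component_set (- drawing (H - {e})) s"
    have "?U \<subseteq> - drawing H"
      using no connected_component_subset[of "- drawing (H - {e})" s]
        edge_Int_drawing[OF eE H] drawing_insert[OF e] by blast
    moreover have "s \<in> ?U" "t \<in> ?U"
      using st(1) connected_component_in
      by (auto simp: same_face_def)
    ultimately have "connected_component (- drawing H) s t"
      unfolding connected_component_def[of "- drawing H"] using connected_connected_component by blast
    then show False using st by (auto simp: same_face_def)
  qed
  obtain p q where pq: "p \<in> ?I" "connected_component (- drawing (H - {e})) x p"
    "q \<in> ?I" "connected_component (- drawing (H - {e})) u q"
    using meet[OF xy] meet[OF uv] by blast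
  have "connected_component (- drawing (H - {e})) p q"
    unfolding connected_component_def using I pq by blast
  then have "connected_component (- drawing (H - {e})) x u"
    using pq connected_component_trans connected_component_sym by metis
  then show ?thesis using xy uv by (auto simp: same_face_def)
qed

end

section \<open>Face boundaries\<close>

text \<open>The combinatorial argument takes from the plane just these facts, with
  \<open>R H\<close> in the role of \<open>same_face H\<close>.\<close>

locale face_relations =
  fixes V :: "'a set" and E :: "'a set set" and X :: "'p set"
    and R :: "'a set set \<Rightarrow> ('p \<times> 'p) set"
  assumes finite_V: "finite V"
    and edgeD: "e \<in> E \<Longrightarrow> e \<subseteq> V \<and> card e = 2"
    and X_nonempty: "X \<noteq> {}"
    and equiv_R: "H \<subseteq> E \<Longrightarrow> equiv X (R H)"
    and R_anti: "H \<subseteq> H' \<Longrightarrow> R H' \<subseteq> R H"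
    and R_empty: "R {} = X \<times> X"
    and R_Int: "H \<subseteq> E \<Longrightarrow> H' \<subseteq> E \<Longrightarrow> R (H \<inter> H') \<subseteq> (R H \<union> R H')\<^sup>*"
    and nonbridge_separates: "H \<subseteq> E \<Longrightarrow> {a, b} \<in> H \<Longrightarrow> (a, b) \<in> reach (H - {{a, b}}) \<Longrightarrow>
      \<exists>x y. (x, y) \<in> R (H - {{a, b}}) \<and> (x, y) \<notin> R H"
    and nonbridge_two_sides: "H \<subseteq> E \<Longrightarrow> {a, b} \<in> H \<Longrightarrow> (a, b) \<in> reach (H - {{a, b}}) \<Longrightarrow>
      (x, y) \<in> R (H - {{a, b}}) \<Longrightarrow> (y, z) \<in> R (H - {{a, b}}) \<Longrightarrow>
      (x, y) \<in> R H \<or> (y, z) \<in> R H \<or> (x, z) \<in> R H"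
    and bridge_one_side: "H \<subseteq> E \<Longrightarrow> {a, b} \<in> H \<Longrightarrow> (a, b) \<notin> reach (H - {{a, b}}) \<Longrightarrow>
      R (H - {{a, b}}) \<subseteq> R H"
    and unique_split_face: "H \<subseteq> E \<Longrightarrow> e \<in> H \<Longrightarrow>
      (x, y) \<in> R (H - {e}) \<Longrightarrow> (x, y) \<notin> R H \<Longrightarrow>
      (u, v) \<in> R (H - {e}) \<Longrightarrow> (u, v) \<notin> R H \<Longrightarrow> (x, u) \<in> R (H - {e})"
begin

text \<open>Only edges with different faces on their two sides are counted: bridges are in no boundary.\<close>

definition boundary :: "'a set set \<Rightarrow> 'p \<Rightarrow> 'a set set" where
  "boundary H x = {e \<in> H. \<exists>y. (x, y) \<in> R (H - {e}) \<and> (x, y) \<notin> R H}"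

lemma finite_E: "finite E"
  using finite_V edgeD by (meson PowI finite_Pow_iff finite_subset subsetI)

lemma edgeE:
  assumes "e \<in> E"
  obtains a b where "e = {a, b}" "a \<noteq> b" "a \<in> V" "b \<in> V"
proof -
  have "e \<subseteq> V" "card e = 2" using edgeD[OF assms] by auto
  then show ?thesis using that by (auto simp: card_2_iff)
qed

lemma R_refl: "H \<subseteq> E \<Longrightarrow> x \<in> X \<Longrightarrow> (x, x) \<in> R H"
  and R_sym: "H \<subseteq> E \<Longrightarrow> (x, y) \<in> R H \<Longrightarrow> (y, x) \<in> R H"
  and R_trans: "H \<subseteq> E \<Longrightarrow> (x, y) \<in> R H \<Longrightarrow> (y, z) \<in> R H \<Longrightarrow> (x, z) \<in> R H"
  and R_X: "H \<subseteq> E \<Longrightarrow> (x, y) \<in> R H \<Longrightarrow> x \<in> X \<and> y \<in> X"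
  using equiv_R[of H] unfolding equiv_def refl_on_def sym_def trans_def by blast+

lemma two_sides:
  assumes "H \<subseteq> E" "e \<in> H" "(x, y) \<in> R (H - {e})" "(y, z) \<in> R (H - {e})"
  shows "(x, y) \<in> R H \<or> (y, z) \<in> R H \<or> (x, z) \<in> R H"
proof -
  obtain a b where e: "e = {a, b}" using assms edgeE[of e] by blast
  show ?thesis
    using nonbridge_two_sides[of H a b x y z] bridge_one_side[of H a b] assms unfolding e by blast
qed

lemma boundary_subset: "boundary H x \<subseteq> H"
  by (auto simp: boundary_def)

lemma boundary_cong:
  assumes "H \<subseteq> E" "(x, y) \<in> R H"
  shows "boundary H x = boundary H y"
proof -
  have "boundary H x \<subseteq> boundary H y" if xy: "(x, y) \<in> R H" for x y
  proof
    fix e assume "e \<in> boundary H x"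
    then obtain z where z: "e \<in> H" "(x, z) \<in> R (H - {e})" "(x, z) \<notin> R H"
      by (auto simp: boundary_def)
    have HE: "H - {e} \<subseteq> E" using assms by blast
    have "(y, x) \<in> R (H - {e})" using R_sym[OF assms(1) xy] R_anti[of "H - {e}" H] by blast
    then have "(y, z) \<in> R (H - {e})" "(y, z) \<notin> R H"
      using z R_trans[OF HE] R_trans[OF assms(1) xy] by blast+
    then show "e \<in> boundary H y" using z(1) by (auto simp: boundary_def)
  qed
  then show ?thesis using assms R_sym by blast
qed

lemma boundary_common:
  assumes "H \<subseteq> E" "e \<in> boundary H x" "e \<in> boundary H y"
  shows "(x, y) \<in> R (H - {e})"
  using assms unique_split_face[of H e x _ y] unfolding boundary_def by blast

text \<open>Deleting \<open>e\<close> merges the three faces into one, and \<open>e\<close> splits a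
  class into at most two.\<close>

lemma boundary_three:
  assumes "H \<subseteq> E" "e \<in> boundary H x" "e \<in> boundary H y" "e \<in> boundary H z"
  shows "(x, y) \<in> R H \<or> (y, z) \<in> R H \<or> (x, z) \<in> R H"
  using two_sides[of H e x y z] boundary_common[of H e x y] boundary_common[of H e y z] assms
  by (auto simp: boundary_def)

text \<open>Edges off the boundary are deleted one at a time. By \<open>R_Int\<close>, a connection
  after the next deletion is a chain of connections that existed before it or that need the deletion
  of this edge alone; neither kind leaves the face of \<open>x\<close>.\<close>

lemma R_boundary:
  assumes H: "H \<subseteq> E" and xy: "(x, y) \<in> R (boundary H x)" and x: "x \<in> X"
  shows "(x, y) \<in> R H"
proof -
  have "(x, y) \<in> R H" if "finite D" "D \<subseteq> H - boundary H x" "(x, y) \<in> R (H - D)" for D y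
    using that
  proof (induction D arbitrary: y rule: finite_induct)
    case (insert e D)
    have e: "e \<in> H" "e \<notin> boundary H x" using insert by auto
    have "(H - D) \<inter> (H - {e}) = H - insert e D" by blast
    then have "(x, y) \<in> (R (H - D) \<union> R (H - {e}))\<^sup>*"
      using R_Int[of "H - D" "H - {e}"] insert.prems(2) H by auto
    then show ?case
    proof (induction rule: rtrancl_induct)
      case base
      show ?case using R_refl H x by blast
    next
      case (step u v)
      have sub: "H - D \<subseteq> E" "H - {e} \<subseteq> E" using H by auto
      have xu: "(x, u) \<in> R (H - D)" "(x, u) \<in> R (H - {e})"
        using step.IH R_anti[of "H - D" H] R_anti[of "H - {e}" H] by blast+
      from step.hyps(2) show ?case
      proof
        assume "(u, v) \<in> R (H - D)"
        then have "(x, v) \<in> R (H - D)" using R_trans[OF sub(1) xu(1)] by blast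
        then show ?thesis using insert by blast
      next
        assume "(u, v) \<in> R (H - {e})"
        then have "(x, v) \<in> R (H - {e})" using R_trans[OF sub(2) xu(2)] by blast
        then show ?thesis using e by (auto simp: boundary_def)
      qed
    qed
  qed simp
  moreover have "finite (H - boundary H x)" using H finite_E finite_subset by blast
  moreover have "H - (H - boundary H x) = boundary H x" using boundary_subset by blast
  ultimately show ?thesis using xy by (metis order_refl)
qed

text \<open>By \<open>R_boundary\<close>, the face of \<open>x\<close> and the face across
  \<open>e\<close> stay apart when only the boundary remains. This allows the boundary to be treated
  as a graph of its own.\<close>

lemma boundary_own_boundary:
  assumes H: "H \<subseteq> E" and "e \<in> boundary H x" and x: "x \<in> X"
  shows "e \<in> boundary (boundary H x) x"
proof -
  obtain y where y: "(x, y) \<in> R (H - {e})" "(x, y) \<notin> R H"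
    using assms by (auto simp: boundary_def)
  have "(x, y) \<in> R (boundary H x - {e})"
    using y R_anti[of "boundary H x - {e}" "H - {e}"] boundary_subset[of H x] by blast
  then show ?thesis
    using assms y R_boundary[OF H _ x] unfolding boundary_def[of "boundary H x"] by blast
qed

text \<open>A bridge of the boundary would separate no faces of the boundary graph, contrary to
  \<open>boundary_own_boundary\<close>.\<close>

lemma boundary_nonbridge:
  assumes H: "H \<subseteq> E" and e: "{a, b} \<in> boundary H x" and x: "x \<in> X"
  shows "(a, b) \<in> reach (boundary H x - {{a, b}})"
proof (rule ccontr)
  assume "(a, b) \<notin> reach (boundary H x - {{a, b}})"
  then have "R (boundary H x - {{a, b}}) \<subseteq> R (boundary H x)"
    using bridge_one_side[of "boundary H x" a b] e boundary_subset[of H x] H by blast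
  moreover have "{a, b} \<in> boundary (boundary H x) x" using boundary_own_boundary assms by blast
  ultimately show False by (auto simp: boundary_def[of "boundary H x"])
qed

lemma boundary_nonempty:
  assumes "H \<subseteq> E" "x \<in> X" "y \<in> X" "(x, y) \<notin> R H"
  shows "boundary H x \<noteq> {}"
  using R_boundary[OF assms(1) _ assms(2), of y] assms R_empty by auto

lemma boundary_cycle:
  assumes H: "H \<subseteq> E" and e: "{a, b} \<in> boundary H x" and x: "x \<in> X"
  obtains p where "distinct p" "length p \<ge> 3" "hd p = a" "last p = b" "path_edges p \<subseteq> boundary H x - {{a, b}}"
proof -
  obtain p where p: "distinct p" "p \<noteq> []" "hd p = a" "last p = b" "path_edges p \<subseteq> boundary H x - {{a, b}}"
    using reach_distinct_path[OF boundary_nonbridge[OF assms]] by blast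
  have "a \<noteq> b" using e boundary_subset[of H x] H edgeD[of "{a, b}"] by auto
  then have "length p \<ge> 3"
    using p by (cases p rule: path_edges.cases; cases "tl (tl p)") auto
  with p that show ?thesis by blast
qed

lemma card_boundary_ge_3:
  assumes H: "H \<subseteq> E" and ne: "boundary H x \<noteq> {}" and x: "x \<in> X"
  shows "card (boundary H x) \<ge> 3"
proof -
  obtain e where e: "e \<in> boundary H x" using ne by blast
  then have "e \<in> E" using boundary_subset[of H x] H by blast
  then obtain a b where ab: "e = {a, b}" using edgeE by blast
  obtain p where p: "distinct p" "length p \<ge> 3" "path_edges p \<subseteq> boundary H x - {e}"
    using boundary_cycle[OF H _ x] e ab by metis
  have fin: "finite (boundary H x)" using boundary_subset[of H x] H finite_E finite_subset by metis
  have "length p - 1 \<le> card (boundary H x - {e})"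
    using card_mono[OF _ p(3)] card_path_edges[OF p(1)] fin by simp
  then show ?thesis using p(2) fin e by simp
qed

text \<open>
  Otherwise \<open>D = boundary H x\<close> has two faces besides that of \<open>x\<close>. Their boundaries within \<open>D\<close> have at least
  three edges each and are disjoint, since every edge of \<open>D\<close> already has the face of \<open>x\<close> on one side.
\<close>

lemma boundary_short_cycle_unique:
  assumes H: "H \<subseteq> E" and x: "x \<in> X" and card: "card (boundary H x) \<le> 5"
    and C: "C \<subseteq> boundary H x" "{a, b} \<in> C" "(a, b) \<in> reach (C - {{a, b}})"
  shows "C = boundary H x"
proof (rule ccontr)
  assume "C \<noteq> boundary H x"
  define D where "D = boundary H x"
  have D: "D \<subseteq> E" using boundary_subset[of H x] H by (auto simp: D_def)
  then have CE: "C \<subseteq> E" using C by (auto simp: D_def)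
  obtain e where e: "e \<in> D" "e \<notin> C" using C \<open>C \<noteq> boundary H x\<close> by (auto simp: D_def)
  obtain c d where cd: "e = {c, d}" using e D edgeE by blast
  obtain p q where pq: "(p, q) \<in> R (C - {{a, b}})" "(p, q) \<notin> R C"
    using nonbridge_separates[OF CE C(2,3)] by blast
  obtain s t where st: "(s, t) \<in> R (D - {e})" "(s, t) \<notin> R D"
    using nonbridge_separates[OF D] boundary_nonbridge[OF H _ x] e unfolding cd D_def by blast
  have De: "D - {e} \<subseteq> E" using D by blast
  have X: "p \<in> X" "q \<in> X" "s \<in> X" "t \<in> X"
    using R_X[OF _ pq(1)] R_X[OF De st(1)] CE by auto
  \<comment> \<open>\<open>C\<close> avoids \<open>e\<close> and separates \<open>p\<close> from
    \<open>q\<close>, so there are two faces even without \<open>e\<close>. As \<open>e\<close>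
    splits one of them, \<open>s\<close>, \<open>t\<close> and \<open>r\<close> lie in three
    different faces of \<open>D\<close>.\<close>
  have "(p, q) \<notin> R (D - {e})"
    using pq(2) R_anti[of C "D - {e}"] C(1) e by (auto simp: D_def)
  then obtain r where r: "r \<in> X" "(s, r) \<notin> R (D - {e})"
    using R_trans[OF De R_sym[OF De]] X by blast
  have "(t, r) \<notin> R (D - {e})" using r st R_trans[OF De] by blast
  then have str: "(s, t) \<notin> R D" "(s, r) \<notin> R D" "(t, r) \<notin> R D"
    using r(2) st(2) R_anti[of "D - {e}" D] by blast+
  \<comment> \<open>At most one of the three is the face of \<open>x\<close>, which leaves two
    others.\<close>
  obtain u v where uv: "u \<in> X" "v \<in> X" "(x, u) \<notin> R D" "(u, v) \<notin> R D" "(x, v) \<notin> R D"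
  proof -
    consider "(x, s) \<in> R D" | "(x, t) \<in> R D" | "(x, s) \<notin> R D" "(x, t) \<notin> R D" by blast
    then show ?thesis
    proof cases
      case 1
      then have "(x, t) \<notin> R D" "(x, r) \<notin> R D"
        using str R_trans[OF D R_sym[OF D 1]] by blast+
      then show ?thesis using that[of t r] X r str by blast
    next
      case 2
      then have "(x, s) \<notin> R D" "(x, r) \<notin> R D"
        using str R_trans[OF D R_sym[OF D 2]] R_sym[OF D] by blast+
      then show ?thesis using that[of s r] X r str by blast
    next
      case 3
      then show ?thesis using that[of s t] X str by blast
    qed
  qed
  have ne: "boundary D u \<noteq> {}" "boundary D v \<noteq> {}"
    using boundary_nonempty[OF D] uv x R_sym[OF D] by metis+
  have "boundary D u \<inter> boundary D v = {}"
  proof (rule equals0I)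
    fix d assume d: "d \<in> boundary D u \<inter> boundary D v"
    then have "d \<in> boundary D x"
      using boundary_own_boundary[OF H _ x] boundary_subset[of D u] unfolding D_def by blast
    then show False using boundary_three[OF D, of d x u v] d uv by blast
  qed
  moreover have fin: "finite D" using D finite_E finite_subset by blast
  ultimately have "card (boundary D u) + card (boundary D v) \<le> card D"
    using boundary_subset by (metis card_Un_disjoint card_mono finite_subset Un_least)
  then show False
    using card_boundary_ge_3[OF D ne(1) uv(1)] card_boundary_ge_3[OF D ne(2) uv(2)] card by (simp add: D_def)
qed

text \<open>By uniqueness, the edge \<open>{a, b}\<close> and a path from \<open>a\<close> to
  \<open>b\<close> in the remaining boundary already make up all of it. The list \<open>p\<close>
  holds the vertices of this cycle in order, with \<open>{a, b}\<close> as the closing edge.\<close>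

lemma boundary_short_is_cycle:
  assumes H: "H \<subseteq> E" and x: "x \<in> X" and card: "card (boundary H x) \<le> 5" and e: "{a, b} \<in> boundary H x"
  obtains p where "distinct p" "length p = card (boundary H x)" "length p \<ge> 3" "hd p = a" "last p = b"
    "boundary H x = insert {a, b} (path_edges p)"
proof -
  obtain p where p: "distinct p" "length p \<ge> 3" "hd p = a" "last p = b" "path_edges p \<subseteq> boundary H x - {{a, b}}"
    using boundary_cycle[OF H e x] by blast
  have "insert {a, b} (path_edges p) - {{a, b}} = path_edges p" using p(5) by blast
  moreover have "(a, b) \<in> reach (path_edges p)" using reach_path_edges[of p] p by fastforce
  ultimately have eq: "insert {a, b} (path_edges p) = boundary H x"
    using boundary_short_cycle_unique[OF H x card, of "insert {a, b} (path_edges p)" a b] p(5) e by auto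
  have "{a, b} \<notin> path_edges p" using p(5) by blast
  then have "card (boundary H x) = Suc (length p - 1)"
    using card_path_edges[OF p(1)] by (simp add: eq[symmetric] finite_path_edges)
  then show ?thesis using that p eq by simp
qed

section \<open>Short faces and common edges of faces\<close>

lemma boundary_triangle:
  assumes "H \<subseteq> E" "x \<in> X" "card (boundary H x) = 3" "{a, b} \<in> boundary H x"
  obtains c where "distinct [a, c, b]" "boundary H x = {{a, b}, {a, c}, {c, b}}"
proof -
  have "card (boundary H x) \<le> 5" using assms(3) by simp
  then obtain p where p: "distinct p" "length p = 3" "hd p = a" "last p = b" "boundary H x = insert {a, b} (path_edges p)"
    using boundary_short_is_cycle[OF assms(1,2) _ assms(4)] assms(3) by metis
  obtain c where c: "p = [a, c, b]"
    using p(2-4) by (auto simp: numeral_3_eq_3 length_Suc_conv)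
  show ?thesis using that[of c] p(1,5) unfolding c by simp
qed

lemma boundary_quadrilateral:
  assumes "H \<subseteq> E" "x \<in> X" "card (boundary H x) = 4" "{a, b} \<in> boundary H x"
  obtains c d where "distinct [a, c, d, b]" "boundary H x = {{a, b}, {a, c}, {c, d}, {d, b}}"
proof -
  have "card (boundary H x) \<le> 5" using assms(3) by simp
  then obtain p where p: "distinct p" "length p = 4" "hd p = a" "last p = b" "boundary H x = insert {a, b} (path_edges p)"
    using boundary_short_is_cycle[OF assms(1,2) _ assms(4)] assms(3) by metis
  obtain c d where cd: "p = [a, c, d, b]"
    using p(2-4) by (auto simp: numeral_eq_Suc length_Suc_conv)
  show ?thesis using that[of c d] p(1,5) unfolding cd by simp
qed

lemma boundary_no_pentagon:
  assumes "\<not> contains_C5 V E" "H \<subseteq> E" "x \<in> X"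
  shows "card (boundary H x) \<noteq> 5"
proof
  assume 5: "card (boundary H x) = 5"
  then obtain e where e: "e \<in> boundary H x" by fastforce
  have sub: "boundary H x \<subseteq> E" using boundary_subset[of H x] assms(2) by blast
  then obtain a b where ab: "e = {a, b}" using e edgeE by blast
  obtain p where p: "distinct p" "length p = 5" "hd p = a" "last p = b" "boundary H x = insert {a, b} (path_edges p)"
    using boundary_short_is_cycle[OF assms(2,3), of a b] 5 e ab by (metis order_refl)
  obtain c d f where p': "p = [a, c, d, f, b]"
    using p(2-4) by (auto simp: numeral_eq_Suc length_Suc_conv)
  have ed: "{a, c} \<in> E" "{c, d} \<in> E" "{d, f} \<in> E" "{f, b} \<in> E" "{b, a} \<in> E"
    using p(5) p' sub by (auto simp: insert_commute)
  then have "{a, c, d, f, b} \<subseteq> V" using edgeD by blast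
  then have "contains_C5 V E"
    unfolding contains_C5_def using ed p(1) p'
    by (intro exI[of _ a] exI[of _ c] exI[of _ d] exI[of _ f] exI[of _ b]) auto
  with assms(1) show False by simp
qed

text \<open>
  Take a cycle through \<open>a\<close>, \<open>b\<close>, \<open>z\<close> that avoids the edge \<open>bc\<close>: it separates the two faces along
  \<open>ab\<close>, but they still meet along \<open>bc\<close>.
\<close>

lemma no_two_common_boundary_edges:
  assumes x: "x \<in> X" and y: "y \<in> X" and xy: "(x, y) \<notin> R E"
    and ab: "{a, b} \<in> boundary E x" "{a, b} \<in> boundary E y"
    and bc: "{b, c} \<in> boundary E x" "{b, c} \<in> boundary E y"
    and z: "{b, z} \<in> E" and dist: "a \<noteq> c" "z \<noteq> a" "z \<noteq> c"
    and conn: "(z, a) \<in> reach {e \<in> E. b \<notin> e}"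
  shows False
proof -
  \<comment> \<open>At \<open>b\<close> only the edges to \<open>a\<close> and \<open>z\<close> are
    kept, so \<open>{b, c}\<close> is missing, while \<open>conn\<close> still closes a cycle
    through \<open>{a, b}\<close>.\<close>
  define H where "H = insert {a, b} (insert {b, z} {e \<in> E. b \<notin> e})"
  have aE: "{a, b} \<in> E" and cE: "{b, c} \<in> E" using ab bc boundary_subset[of E x] by auto
  have ne: "a \<noteq> b" "b \<noteq> z" "b \<noteq> c"
    using edgeD[OF aE] edgeD[OF z] edgeD[OF cE] by auto
  have HE: "H \<subseteq> E" using aE z by (auto simp: H_def)
  have HE': "H - {{a, b}} \<subseteq> E" using HE by blast
  have "{b, c} \<notin> H" using ne dist by (auto simp: H_def doubleton_eq_iff)
  then have Hc: "H \<subseteq> E - {{b, c}}" using HE by blast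
  have "(x, y) \<in> R (E - {{b, c}})" using boundary_common[OF order_refl] bc by blast
  then have xyH: "(x, y) \<in> R H" using R_anti[OF Hc] by blast
  have ed: "{e \<in> E. b \<notin> e} \<subseteq> H - {{a, b}}" "{b, z} \<in> H - {{a, b}}"
    using ne dist by (auto simp: H_def doubleton_eq_iff)
  have "(b, a) \<in> reach (H - {{a, b}})"
    using reach_trans[OF reach_edge[OF ed(2)]] conn reach_mono[OF ed(1)] by blast
  then have "(a, b) \<in> reach (H - {{a, b}})" by (rule reach_sym)
  then obtain u v where uv: "(u, v) \<in> R (H - {{a, b}})" "(u, v) \<notin> R H"
    using nonbridge_separates[OF HE, of a b] unfolding H_def by blast
  have "H \<inter> (E - {{a, b}}) = H - {{a, b}}" using HE by blast
  then have "(u, v) \<in> (R H \<union> R (E - {{a, b}}))\<^sup>*"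
    using R_Int[OF HE, of "E - {{a, b}}"] uv(1) by auto
  \<comment> \<open>Deleting \<open>{a, b}\<close> from \<open>E\<close> merges only the faces of
    \<open>x\<close> and \<open>y\<close>, which \<open>H\<close> does not separate. Hence deleting
    it from \<open>H\<close> would merge nothing, although it lies on a cycle of
    \<open>H\<close>.\<close>
  moreover have "R (E - {{a, b}}) \<subseteq> R H"
  proof clarify
    fix s t assume st: "(s, t) \<in> R (E - {{a, b}})"
    show "(s, t) \<in> R H"
    proof (cases "(s, t) \<in> R E")
      case True
      then show ?thesis using R_anti[OF HE] by blast
    next
      case False
      have "(t, s) \<in> R (E - {{a, b}})" "(t, s) \<notin> R E"
        using st False R_sym[of "E - {{a, b}}"] R_sym[of E] by blast+
      then have b: "{a, b} \<in> boundary E s" "{a, b} \<in> boundary E t"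
        using st False aE by (auto simp: boundary_def)
      have near: "(w, x) \<in> R H" if "{a, b} \<in> boundary E w" for w
      proof -
        have "(x, y) \<in> R E \<or> (y, w) \<in> R E \<or> (x, w) \<in> R E"
          using boundary_three[OF order_refl ab that] by blast
        then show ?thesis
          using xy xyH R_anti[OF HE] R_sym[OF HE] R_trans[OF HE] by blast
      qed
      show ?thesis using near[OF b(1)] near[OF b(2)] R_sym[OF HE] R_trans[OF HE] by blast
    qed
  qed
  then have "R H \<union> R (E - {{a, b}}) = R H" by blast
  ultimately have "(u, v) \<in> (R H)\<^sup>*" by simp
  then have "(u, v) \<in> R H"
  proof (induction rule: rtrancl_induct)
    case base
    show ?case using uv(1) R_X[OF HE'] R_refl[OF HE] by blast
  next
    case (step s t)
    then show ?case using R_trans[OF HE] by blast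
  qed
  with uv(2) show False by simp
qed

section \<open>Euler's inequality\<close>

lemma finite_faces: "H \<subseteq> E \<Longrightarrow> finite (X // R H)"
proof -
  assume H: "H \<subseteq> E"
  show ?thesis
    using finite_subset[OF H finite_E] H
  proof (induction H rule: finite_subset_induct')
    case empty
    have "X // R {} \<subseteq> {X}" unfolding R_empty quotient_def by auto
    then show ?case using finite_subset by blast
  next
    case (insert e H)
    have HE: "insert e H \<subseteq> E" "H \<subseteq> E" using insert by auto
    have He: "insert e H - {e} = H" using insert by blast
    show ?case
    proof (rule finite_quotient_split[OF equiv_R[OF HE(1)] equiv_R[OF HE(2)]])
      show "R (insert e H) \<subseteq> R H" by (intro R_anti) blast
      show "finite (X // R H)" using insert by blast
    qed (use two_sides[OF HE(1), of e] He in auto)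
  qed
qed

lemma equiv_reach: "H \<subseteq> E \<Longrightarrow> equiv V (reach H \<inter> V \<times> V)"
  by (rule equivI) (auto simp: refl_on_def sym_def trans_def intro: reach_sym reach_trans)

text \<open>One half of Euler's formula, by inserting the edges one at a time: an edge between
  connected vertices raises the number of faces, any other edge lowers the number of components. At
  the end at least one component is left.\<close>

lemma euler_lower:
  assumes "V \<noteq> {}"
  shows "card E + 2 \<le> card (X // R E) + card V"
proof -
  let ?comp = "\<lambda>H. V // (reach H \<inter> V \<times> V)"
  have fin: "finite (?comp H)" for H
    unfolding quotient_def using finite_V by auto
  have "card H + card (?comp H) + 1 \<le> card (X // R H) + card V" if "H \<subseteq> E" for H
    using finite_subset[OF that finite_E] that
  proof (induction H rule: finite_subset_induct')
    case empty
    have "reach {} = Id" by (auto simp: reach_def)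
    then have "?comp {} = (\<lambda>v. {v}) ` V" unfolding quotient_def by auto
    then have "card (?comp {}) = card V" by (simp add: card_image)
    moreover have "card (X // R {}) > 0"
      using finite_faces[of "{}"] X_nonempty by (auto simp: card_gt_0_iff quotient_def)
    ultimately show ?case by simp
  next
    case (insert e H)
    have HE: "insert e H \<subseteq> E" "H \<subseteq> E" using insert by auto
    have He: "insert e H - {e} = H" using insert by blast
    obtain a b where ab: "e = {a, b}" "a \<in> V" "b \<in> V" using edgeE[of e] insert by blast
    have R: "R (insert e H) \<subseteq> R H" by (intro R_anti) blast
    have K: "reach H \<inter> V \<times> V \<subseteq> reach (insert e H) \<inter> V \<times> V"
      using reach_mono[of H "insert e H"] by blast
    note cR = card_quotient_mono[OF equiv_R[OF HE(1)] equiv_R[OF HE(2)] R finite_faces[OF HE(1)]]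
    note cK = card_quotient_mono[OF equiv_reach[OF HE(2)] equiv_reach[OF HE(1)] K fin]
    have "card (?comp (insert e H)) + card (X // R H) < card (?comp H) + card (X // R (insert e H))"
    proof (cases "(a, b) \<in> reach H")
      case True
      then have "R (insert e H) \<noteq> R H"
        using nonbridge_separates[OF HE(1), of a b] He by (auto simp: ab(1))
      then show ?thesis using cR cK by linarith
    next
      case False
      moreover have "(a, b) \<in> reach (insert e H)"
        using ab(1) by (intro reach_edge) simp
      ultimately have "reach H \<inter> V \<times> V \<noteq> reach (insert e H) \<inter> V \<times> V"
        using ab by blast
      then show ?thesis using cR cK by linarith
    qed
    then show ?case using insert by simp
  qed
  moreover have "card (?comp E) > 0"
    using fin assms by (auto simp: card_gt_0_iff quotient_def)
  ultimately show ?thesis using order_refl[of E] by fastforce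
qed

end

section \<open>Discharging\<close>

text \<open>Three counts are combined: of all incidences of edges with faces, of those at 4-faces,
  and of the edges of triangular faces, shared out among these faces.\<close>

lemma face_discharging:
  fixes \<Phi> :: "'f set" and E :: "'e set" and B :: "'f \<Rightarrow> 'e set"
  assumes fin: "finite \<Phi>" "finite E"
    and sub: "\<And>F. F \<in> \<Phi> \<Longrightarrow> B F \<subseteq> E"
    and two: "\<And>e. e \<in> E \<Longrightarrow> card {F \<in> \<Phi>. e \<in> B F} \<le> 2"
    and size: "\<And>F. F \<in> \<Phi> \<Longrightarrow> card (B F) = 3 \<or> card (B F) = 4 \<or> card (B F) \<ge> 6"
    and disj: "\<And>F F'. F \<in> \<Phi> \<Longrightarrow> F' \<in> \<Phi> \<Longrightarrow> card (B F) = 3 \<Longrightarrow> card (B F') = 4 \<Longrightarrow> B F \<inter> B F' = {}"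
    and shared: "\<And>F. F \<in> \<Phi> \<Longrightarrow> card (B F) = 3 \<Longrightarrow>
      card {e \<in> B F. \<exists>F'\<in>\<Phi>. F' \<noteq> F \<and> card (B F') = 3 \<and> e \<in> B F'} \<le> 1"
  shows "15 * card \<Phi> \<le> 8 * card E"
proof -
  define T where "T = {F \<in> \<Phi>. card (B F) = 3}"
  define Q where "Q = {F \<in> \<Phi>. card (B F) = 4}"
  define L where "L = {F \<in> \<Phi>. card (B F) \<ge> 6}"
  define A where "A = (\<Union>F\<in>T. B F)"
  define t where "t e = card {F \<in> T. e \<in> B F}" for e
  have finT: "finite T" "finite Q" "finite L" using fin by (auto simp: T_def Q_def L_def)
  have AE: "A \<subseteq> E" using sub by (auto simp: A_def T_def)
  have finA: "finite A" using AE fin finite_subset by blast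
  have finB: "finite (B F)" if "F \<in> \<Phi>" for F using sub[OF that] fin finite_subset by blast
  have \<Phi>: "\<Phi> = T \<union> Q \<union> L" "T \<inter> Q = {}" "(T \<union> Q) \<inter> L = {}"
    using size by (auto simp: T_def Q_def L_def)
  have card\<Phi>: "card \<Phi> = card T + card Q + card L"
    unfolding \<Phi>(1) using finT \<Phi>(2,3) by (simp add: card_Un_disjoint)
  have count: "(\<Sum>F\<in>\<Psi>. card {e \<in> D. e \<in> B F}) \<le> 2 * card D"
    if "\<Psi> \<subseteq> \<Phi>" "D \<subseteq> E" for \<Psi> D
  proof -
    have f: "finite \<Psi>" "finite D" using that fin finite_subset by blast+
    have "(\<Sum>F\<in>\<Psi>. card {e \<in> D. e \<in> B F}) = (\<Sum>e\<in>D. card {F \<in> \<Psi>. e \<in> B F})"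
      using f by (intro sum_multicount_gen) auto
    also have "\<dots> \<le> (\<Sum>e\<in>D. 2)"
    proof (rule sum_mono)
      fix e assume "e \<in> D"
      have "card {F \<in> \<Psi>. e \<in> B F} \<le> card {F \<in> \<Phi>. e \<in> B F}"
        using that fin by (intro card_mono) auto
      then show "card {F \<in> \<Psi>. e \<in> B F} \<le> 2" using two \<open>e \<in> D\<close> that by fastforce
    qed
    finally show ?thesis by simp
  qed
  have total: "3 * card T + 4 * card Q + 6 * card L \<le> 2 * card E"
  proof -
    have "(\<Sum>F\<in>\<Phi>. card (B F)) = (\<Sum>F\<in>\<Phi>. card {e \<in> E. e \<in> B F})"
    proof (rule sum.cong)
      fix F assume "F \<in> \<Phi>"
      then have "{e \<in> E. e \<in> B F} = B F" using sub by blast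
      then show "card (B F) = card {e \<in> E. e \<in> B F}" by simp
    qed simp
    then have "(\<Sum>F\<in>\<Phi>. card (B F)) \<le> 2 * card E" using count by simp
    moreover have "(\<Sum>F\<in>\<Phi>. card (B F)) = (\<Sum>F\<in>T. card (B F)) + (\<Sum>F\<in>Q. card (B F)) + (\<Sum>F\<in>L. card (B F))"
      unfolding \<Phi>(1) using finT \<Phi>(2,3) by (simp add: sum.union_disjoint)
    moreover have "(\<Sum>F\<in>T. card (B F)) = 3 * card T" by (simp add: T_def)
    moreover have "(\<Sum>F\<in>Q. card (B F)) = 4 * card Q" by (simp add: Q_def)
    moreover have "(\<Sum>F\<in>L. card (B F)) \<ge> (\<Sum>F\<in>L. 6)" by (intro sum_mono) (simp add: L_def)
    ultimately show ?thesis by simp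
  qed
  \<comment> \<open>The edges of 4-faces lie off \<open>A\<close>, and each is on at most two
    faces.\<close>
  have quad: "4 * card Q \<le> 2 * (card E - card A)"
  proof -
    have "(\<Sum>F\<in>Q. card (B F)) = (\<Sum>F\<in>Q. card {e \<in> E - A. e \<in> B F})"
    proof (rule sum.cong)
      fix F assume F: "F \<in> Q"
      then have "B F \<inter> A = {}" using disj by (auto simp: Q_def A_def T_def)
      then have "{e \<in> E - A. e \<in> B F} = B F" using sub F by (auto simp: Q_def)
      then show "card (B F) = card {e \<in> E - A. e \<in> B F}" by simp
    qed simp
    moreover have "\<dots> \<le> 2 * card (E - A)" by (intro count) (auto simp: Q_def)
    moreover have "(\<Sum>F\<in>Q. card (B F)) = 4 * card Q" by (simp add: Q_def)
    ultimately show ?thesis using card_Diff_subset[OF finA AE] by simp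
  qed
  \<comment> \<open>Each edge of \<open>A\<close> splits weight 1 evenly among the triangular faces
    at it. A triangle has at most one shared edge, worth at least 1/2 to it, and so receives at
    least 5/2.\<close>
  have tri: "5 / 2 * real (card T) \<le> real (card A)"
  proof -
    have "5 / 2 \<le> (\<Sum>e\<in>B F. 1 / real (t e))" if F: "F \<in> T" for F
    proof -
      define S where "S = {e \<in> B F. \<exists>F'\<in>\<Phi>. F' \<noteq> F \<and> card (B F') = 3 \<and> e \<in> B F'}"
      have F\<Phi>: "F \<in> \<Phi>" "card (B F) = 3" using F by (auto simp: T_def)
      have SB: "S \<subseteq> B F" by (auto simp: S_def)
      have S1: "card S \<le> 1" using shared[OF F\<Phi>] by (simp add: S_def)
      have finS: "finite S" using SB finB[OF F\<Phi>(1)] finite_subset by blast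
      have "1 / real (t e) = 1" if e: "e \<in> B F - S" for e
      proof -
        have "{F \<in> T. e \<in> B F} = {F}" using e F by (auto simp: S_def T_def)
        then show ?thesis by (simp add: t_def)
      qed
      then have "(\<Sum>e\<in>B F - S. 1 / real (t e)) = real (card (B F - S))" by simp
      moreover have "(\<Sum>e\<in>S. 1 / 2) \<le> (\<Sum>e\<in>S. 1 / real (t e))"
      proof (rule sum_mono)
        fix e assume "e \<in> S"
        then have e: "e \<in> B F" "e \<in> E" using SB sub F\<Phi> by auto
        have "t e \<le> card {F \<in> \<Phi>. e \<in> B F}"
          unfolding t_def using fin by (intro card_mono) (auto simp: T_def)
        then have "t e \<le> 2" using two[OF e(2)] by simp
        moreover have "t e > 0" unfolding t_def using F e finT by (auto simp: card_gt_0_iff)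
        ultimately show "1 / 2 \<le> 1 / real (t e)" by (simp add: field_simps)
      qed
      moreover have "(\<Sum>e\<in>B F. 1 / real (t e)) = (\<Sum>e\<in>B F - S. 1 / real (t e)) + (\<Sum>e\<in>S. 1 / real (t e))"
        using SB finB[OF F\<Phi>(1)] by (rule sum.subset_diff)
      moreover have "real (card (B F - S)) = 3 - real (card S)"
        using card_Diff_subset[OF finS SB] F\<Phi>(2) S1 by simp
      ultimately show ?thesis using S1 by simp
    qed
    then have "(\<Sum>F\<in>T. 5 / 2) \<le> (\<Sum>F\<in>T. \<Sum>e\<in>B F. 1 / real (t e))" by (intro sum_mono)
    also have "\<dots> = (\<Sum>F\<in>T. \<Sum>e\<in>{e \<in> A. e \<in> B F}. 1 / real (t e))"
      by (intro sum.cong) (auto simp: A_def)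
    also have "\<dots> = (\<Sum>e\<in>A. \<Sum>F\<in>{F \<in> T. e \<in> B F}. 1 / real (t e))"
      using finT finA by (intro sum.swap_restrict) auto
    also have "\<dots> = (\<Sum>e\<in>A. 1)"
    proof (rule sum.cong)
      fix e assume "e \<in> A"
      then have "t e > 0" unfolding t_def using finT by (auto simp: card_gt_0_iff A_def)
      then show "(\<Sum>F\<in>{F \<in> T. e \<in> B F}. 1 / real (t e)) = 1" by (simp add: t_def)
    qed simp
    finally show ?thesis by simp
  qed
  have AE': "card A \<le> card E" using AE fin card_mono by blast
  then have "4 * card Q + 2 * card A \<le> 2 * card E" using quad by simp
  then have "4 * real (card Q) + 2 * real (card A) \<le> 2 * real (card E)" by linarith
  moreover have "3 * real (card T) + 4 * real (card Q) + 6 * real (card L) \<le> 2 * real (card E)"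
    using total by linarith
  \<comment> \<open>Adding 5/2 times the count of all incidences, 5/4 times the one for 4-faces and
    3 times \<open>tri\<close> gives 15/2 of \<open>card E\<close> plus 1/2 of \<open>card A\<close>
    as an upper bound, and \<open>card A \<le> card E\<close>.\<close>
  ultimately have "15 * real (card \<Phi>) \<le> 8 * real (card E)"
    using tri AE' unfolding card\<Phi> by simp
  then show ?thesis by linarith
qed

section \<open>The bound for plane graphs without cut vertices\<close>

sublocale plane_graph \<subseteq> face_relations V E X same_face
  by unfold_locales
     (fact finite_V edgeD X_nonempty equiv_same_face same_face_anti same_face_empty same_face_Int
        nonbridge_separates nonbridge_two_sides bridge_one_side unique_split_face)+

context plane_graph
begin

lemma third_edge:
  assumes "degree E b \<ge> 3" "b \<in> V"
  obtains z where "{b, z} \<in> E" "z \<noteq> a" "z \<noteq> c"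
proof -
  have "\<not> {e \<in> E. b \<in> e} \<subseteq> {{b, a}, {b, c}}"
  proof
    assume "{e \<in> E. b \<in> e} \<subseteq> {{b, a}, {b, c}}"
    then have "degree E b \<le> card {{b, a}, {b, c}}"
      unfolding degree_def by (intro card_mono) auto
    also have "\<dots> \<le> 2" by (simp add: card_insert_if)
    finally show False using assms by simp
  qed
  then obtain e where e: "e \<in> E" "b \<in> e" "e \<noteq> {b, a}" "e \<noteq> {b, c}" by blast
  obtain u v where uv: "e = {u, v}" using edgeE[OF e(1)] by blast
  then obtain z where "e = {b, z}" using e(2) by blast
  with e that show ?thesis by blast
qed

text \<open>By \<open>conn\<close> the neighbours of a vertex stay connected after its removal,
  which rules out cut vertices. Discharging bounds the number of faces by 8/15 of
  \<open>card E\<close>, and Euler's inequality times 15 then gives the claim.\<close>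

lemma locally_2_connected_bound:
  assumes deg: "\<forall>v\<in>V. degree E v \<ge> 3"
    and K4: "\<not> contains_K4 V E" and C5: "\<not> contains_C5 V E" and n: "card V \<ge> 3"
    and conn: "\<And>b a z. {b, a} \<in> E \<Longrightarrow> {b, z} \<in> E \<Longrightarrow> (z, a) \<in> reach {e \<in> E. b \<notin> e}"
  shows "7 * card E + 30 \<le> 15 * card V"
proof -
  define \<Phi> where "\<Phi> = X // same_face E"
  \<comment> \<open>All points of a face have the same boundary, so this union is the boundary of
    any one of them.\<close>
  define B where "B F = (\<Union>x\<in>F. boundary E x)" for F
  have finite_\<Phi>: "finite \<Phi>" using finite_faces[OF order_refl] by (simp add: \<Phi>_def)
  have faceE: "\<exists>x\<in>X. F = same_face E `` {x} \<and> B F = boundary E x" if F: "F \<in> \<Phi>" for F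
  proof -
    obtain x where x: "x \<in> X" "F = same_face E `` {x}"
      using F unfolding \<Phi>_def by (rule quotientE)
    have "boundary E y = boundary E x" if "y \<in> F" for y
      using boundary_cong[OF order_refl, of x y] that x by auto
    moreover have "x \<in> F" using x R_refl[OF order_refl] by blast
    ultimately show ?thesis using x unfolding B_def by blast
  qed
  have distinct_faces: "(x, y) \<notin> same_face E"
    if "same_face E `` {x} \<noteq> same_face E `` {y}" for x y
    using that equiv_class_eq[OF equiv_R[OF order_refl]] by blast
  \<comment> \<open>The degree condition supplies a third edge \<open>{b, z}\<close> at
    \<open>b\<close>, and \<open>conn\<close> joins \<open>z\<close> to \<open>a\<close> off
    \<open>b\<close>.\<close>
  have share: False
    if "x \<in> X" "y \<in> X" "(x, y) \<notin> same_face E" "{a, b} \<in> boundary E x" "{a, b} \<in> boundary E y"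
      "{b, c} \<in> boundary E x" "{b, c} \<in> boundary E y" "a \<noteq> c" for x y a b c
  proof -
    have ab: "{a, b} \<in> E" "{b, a} \<in> E" using that(4) boundary_subset[of E x] by (auto simp: insert_commute)
    then have "b \<in> V" using edgeD by blast
    then obtain z where z: "{b, z} \<in> E" "z \<noteq> a" "z \<noteq> c"
      using third_edge deg by metis
    show False
      using no_two_common_boundary_edges[OF that(1-7) z(1) that(8) z(2,3)] conn[OF ab(2) z(1)] by blast
  qed
  have euler: "card E + 2 \<le> card \<Phi> + card V"
    unfolding \<Phi>_def using n by (intro euler_lower) auto
  show ?thesis
  proof (cases "card \<Phi> \<le> 1")
    case True
    \<comment> \<open>With at most one face, \<open>card E \<le> card V - 1\<close>. The claim
      follows from \<open>7 * card V + 23 \<le> 15 * card V\<close>, which holds from 3 vertices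
      on.\<close>
    then show ?thesis using euler n by linarith
  next
    case False
    have "15 * card \<Phi> \<le> 8 * card E"
    proof (rule face_discharging[OF finite_\<Phi> finite_E])
      show BE: "B F \<subseteq> E" for F
        using boundary_subset[of E] by (auto simp: B_def)
      show "card {F \<in> \<Phi>. e \<in> B F} \<le> 2" for e
      proof (rule ccontr)
        assume "\<not> card {F \<in> \<Phi>. e \<in> B F} \<le> 2"
        then have "3 \<le> card {F \<in> \<Phi>. e \<in> B F}" by simp
        then obtain T where T: "T \<subseteq> {F \<in> \<Phi>. e \<in> B F}" "card T = 3"
          by (meson obtain_subset_with_card_n)
        obtain F G K where FGK: "T = {F, G, K}" "F \<noteq> G" "G \<noteq> K" "F \<noteq> K"
          using T(2) by (auto simp: card_3_iff)
        have \<Phi>3: "F \<in> \<Phi>" "G \<in> \<Phi>" "K \<in> \<Phi>" and e: "e \<in> B F" "e \<in> B G" "e \<in> B K"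
          using T(1) FGK(1) by auto
        obtain x where x: "F = same_face E `` {x}" "B F = boundary E x" using faceE[OF \<Phi>3(1)] by blast
        obtain y where y: "G = same_face E `` {y}" "B G = boundary E y" using faceE[OF \<Phi>3(2)] by blast
        obtain z where z: "K = same_face E `` {z}" "B K = boundary E z" using faceE[OF \<Phi>3(3)] by blast
        show False
          using boundary_three[OF order_refl, of e x y z] e FGK distinct_faces x y z by metis
      qed
      show "card (B F) = 3 \<or> card (B F) = 4 \<or> card (B F) \<ge> 6" if F: "F \<in> \<Phi>" for F
      proof -
        obtain x where x: "x \<in> X" "F = same_face E `` {x}" "B F = boundary E x" using faceE[OF F] by blast
        have "\<not> \<Phi> \<subseteq> {F}"
          using False card_mono[of "{F}" \<Phi>] by auto
        then obtain G where G: "G \<in> \<Phi>" "G \<noteq> F" by blast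
        obtain y where y: "y \<in> X" "G = same_face E `` {y}" using faceE[OF G(1)] by blast
        have "boundary E x \<noteq> {}"
          using boundary_nonempty[OF order_refl x(1) y(1)] distinct_faces x y G by metis
        then show ?thesis
          using card_boundary_ge_3[OF order_refl _ x(1)] boundary_no_pentagon[OF C5 order_refl x(1)]
          unfolding x(3) by fastforce
      qed
      show "B F \<inter> B F' = {}"
        if F: "F \<in> \<Phi>" "F' \<in> \<Phi>" "card (B F) = 3" "card (B F') = 4" for F F'
      proof (rule equals0I)
        fix e assume e: "e \<in> B F \<inter> B F'"
        then obtain a b where ab: "e = {a, b}" using BE edgeE by blast
        obtain x where x: "x \<in> X" "F = same_face E `` {x}" "B F = boundary E x" using faceE[OF F(1)] by blast
        obtain y where y: "y \<in> X" "F' = same_face E `` {y}" "B F' = boundary E y" using faceE[OF F(2)] by blast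
        have "F \<noteq> F'" using F by auto
        then have xy: "(x, y) \<notin> same_face E" using distinct_faces x y by blast
        have e': "{a, b} \<in> boundary E x" "{a, b} \<in> boundary E y" "{b, a} \<in> boundary E x" "{b, a} \<in> boundary E y"
          using e x(3) y(3) ab by (auto simp: insert_commute)
        obtain c where c: "distinct [a, c, b]" "boundary E x = {{a, b}, {a, c}, {c, b}}"
          using boundary_triangle[OF order_refl x(1) _ e'(1)] F(3) x(3) by metis
        obtain d g where dg: "distinct [a, d, g, b]" "boundary E y = {{a, b}, {a, d}, {d, g}, {g, b}}"
          using boundary_quadrilateral[OF order_refl y(1) _ e'(2)] F(4) y(3) by metis
        \<comment> \<open>If the third vertex \<open>c\<close> of the triangle were \<open>d\<close>
          or \<open>g\<close>, the two faces would share two consecutive edges. Otherwise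
          \<open>a\<close>, \<open>c\<close>, \<open>b\<close>, \<open>g\<close>, \<open>d\<close>
          is a 5-cycle.\<close>
        have "c \<noteq> d"
        proof
          assume "c = d"
          then have "{a, c} \<in> boundary E x" "{a, c} \<in> boundary E y" using c dg by auto
          then show False using share[OF x(1) y(1) xy e'(3,4), of c] c by auto
        qed
        moreover have "c \<noteq> g"
        proof
          assume "c = g"
          then have "{b, c} \<in> boundary E x" "{b, c} \<in> boundary E y" using c dg by (auto simp: insert_commute)
          then show False using share[OF x(1) y(1) xy e'(1,2), of c] c by auto
        qed
        moreover have ed: "{a, c} \<in> E" "{c, b} \<in> E" "{b, g} \<in> E" "{g, d} \<in> E" "{d, a} \<in> E"
          using c dg boundary_subset[of E x] boundary_subset[of E y] by (auto simp: insert_commute)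
        moreover have "{a, c, b, g, d} \<subseteq> V" using ed edgeD by blast
        ultimately have "contains_C5 V E"
          unfolding contains_C5_def using c(1) dg(1)
          by (intro exI[of _ a] exI[of _ c] exI[of _ b] exI[of _ g] exI[of _ d]) auto
        with C5 show False by simp
      qed
      show "card {e \<in> B F. \<exists>F'\<in>\<Phi>. F' \<noteq> F \<and> card (B F') = 3 \<and> e \<in> B F'} \<le> 1"
        if F: "F \<in> \<Phi>" "card (B F) = 3" for F
      proof (rule ccontr)
        let ?S = "{e \<in> B F. \<exists>F'\<in>\<Phi>. F' \<noteq> F \<and> card (B F') = 3 \<and> e \<in> B F'}"
        assume "\<not> card ?S \<le> 1"
        then have "2 \<le> card ?S" by simp
        then obtain D where D: "D \<subseteq> ?S" "card D = 2" by (meson obtain_subset_with_card_n)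
        obtain e e' where ee: "D = {e, e'}" "e \<noteq> e'" using D(2) by (auto simp: card_2_iff)
        have e: "e \<in> ?S" "e' \<in> ?S" using D(1) ee by auto
        obtain x where x: "x \<in> X" "F = same_face E `` {x}" "B F = boundary E x" using faceE[OF F(1)] by blast
        \<comment> \<open>The triangular face across a shared edge has its third vertex
          \<open>d\<close> off the first triangle, again because two faces share no two consecutive
          edges.\<close>
        have third: "\<exists>d. {a, d} \<in> E \<and> {d, b} \<in> E \<and> d \<noteq> a \<and> d \<noteq> b \<and> d \<noteq> c"
          if "{a, b} \<in> ?S" "boundary E x = {{a, b}, {a, c}, {c, b}}" "distinct [a, c, b]" for a b c
        proof -
          obtain F' where F': "F' \<in> \<Phi>" "F' \<noteq> F" "card (B F') = 3" "{a, b} \<in> B F'"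
            using \<open>{a, b} \<in> ?S\<close> by blast
          obtain y where y: "y \<in> X" "F' = same_face E `` {y}" "B F' = boundary E y"
            using faceE[OF F'(1)] by blast
          have xy: "(x, y) \<notin> same_face E" using distinct_faces x y F'(2) by blast
          have ab: "{a, b} \<in> boundary E x" "{a, b} \<in> boundary E y"
            using \<open>{a, b} \<in> ?S\<close> F'(4) x(3) y(3) by auto
          obtain d where d: "distinct [a, d, b]" "boundary E y = {{a, b}, {a, d}, {d, b}}"
            using boundary_triangle[OF order_refl y(1) _ ab(2)] F'(3) y(3) by metis
          have "d \<noteq> c"
          proof
            assume "d = c"
            then have "{b, c} \<in> boundary E x" "{b, c} \<in> boundary E y"
              using d that(2) by (auto simp: insert_commute)
            then show False using share[OF x(1) y(1) xy ab, of c] that(3) by auto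
          qed
          moreover have "{a, d} \<in> E" "{d, b} \<in> E" using d boundary_subset[of E y] by auto
          ultimately show ?thesis using d(1) by auto
        qed
        have "e \<in> E" using e(1) BE by blast
        then obtain a b where ab: "e = {a, b}" using edgeE by blast
        have "{a, b} \<in> boundary E x" using e(1) ab x(3) by auto
        then obtain c where c: "distinct [a, c, b]" "boundary E x = {{a, b}, {a, c}, {c, b}}"
          using boundary_triangle[OF order_refl x(1)] F(2) x(3) by metis
        have "e' \<in> boundary E x" using e(2) x(3) by auto
        then have "e' = {a, c} \<or> e' = {c, b}" using c(2) ee(2) ab by blast
        \<comment> \<open>The vertices are renamed so that the two shared edges meet in
          \<open>v\<close>.\<close>
        then obtain u v w where uvw: "{u, v} = e" "{v, w} = e'" "distinct [u, v, w]"
          "boundary E x = {{u, v}, {v, w}, {w, u}}"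
        proof
          assume "e' = {a, c}"
          then show ?thesis using that[of b a c] ab c by (auto simp: insert_commute)
        next
          assume "e' = {c, b}"
          then show ?thesis using that[of a b c] ab c by (auto simp: insert_commute)
        qed
        have 1: "boundary E x = {{u, v}, {u, w}, {w, v}}" "boundary E x = {{v, w}, {v, u}, {u, w}}"
          using uvw(4) by (auto simp: insert_commute)
        obtain d where d: "{u, d} \<in> E" "{d, v} \<in> E" "d \<noteq> u" "d \<noteq> v" "d \<noteq> w"
          using third[OF _ 1(1)] e(1) uvw by auto
        obtain g where g: "{v, g} \<in> E" "{g, w} \<in> E" "g \<noteq> v" "g \<noteq> w" "g \<noteq> u"
          using third[OF _ 1(2)] e(2) uvw by auto
        have tri: "{u, v} \<in> E" "{v, w} \<in> E" "{u, w} \<in> E" "{w, u} \<in> E"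
          using uvw(4) boundary_subset[of E x] by (auto simp: insert_commute)
        have inV: "u \<in> V" "v \<in> V" "w \<in> V" "d \<in> V" "g \<in> V"
          using tri d(1) g(1) edgeD by blast+
        show False
        \<comment> \<open>A common third vertex gives a complete graph on \<open>u\<close>,
          \<open>v\<close>, \<open>w\<close>, \<open>d\<close>; different ones give the 5-cycle
          \<open>u\<close>, \<open>d\<close>, \<open>v\<close>, \<open>g\<close>,
          \<open>w\<close>.\<close>
        proof (cases "d = g")
          case True
          then have "contains_K4 V E"
            unfolding contains_K4_def using tri d g uvw(3) inV
            by (intro exI[of _ u] exI[of _ v] exI[of _ w] exI[of _ d]) (auto simp: insert_commute)
          with K4 show False by simp
        next
          case False
          then have "contains_C5 V E"
            unfolding contains_C5_def using tri d g uvw(3) inV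
            by (intro exI[of _ u] exI[of _ d] exI[of _ v] exI[of _ g] exI[of _ w]) auto
          with C5 show False by simp
        qed
      qed
    qed
    then show ?thesis using euler by linarith
  qed
qed

end

section \<open>Subgraphs, cut vertices and the bound without a degree condition\<close>

lemma plane_graph_subgraph:
  assumes "plane_graph V E f \<gamma>" "V' \<subseteq> V" "E' \<subseteq> E" "\<And>e. e \<in> E' \<Longrightarrow> e \<subseteq> V'"
  shows "plane_graph V' E' f \<gamma>"
proof -
  interpret plane_graph V E f \<gamma> by fact
  show ?thesis
  proof
    show "simple_graph V' E'"
      unfolding simple_graph_def
      using finite_subset[OF assms(2) finite_V] assms(4) edgeD subsetD[OF assms(3)] by blast
    have "path_image (\<gamma> e) \<inter> f ` V' = f ` e" if "e \<in> E'" for e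
      using edge_Int_V[OF subsetD[OF assms(3) that]] assms(2) assms(4)[OF that] by blast
    then show "plane_embedding V' E' f \<gamma>"
      unfolding plane_embedding_def
      using inj_on_subset[OF inj_f assms(2)] arc_edge ends_edge edge_Int_edge subsetD[OF assms(3)]
      by simp
  qed
qed

lemma contains_K4_mono: "contains_K4 V' E' \<Longrightarrow> V' \<subseteq> V \<Longrightarrow> E' \<subseteq> E \<Longrightarrow> contains_K4 V E"
  unfolding contains_K4_def by (meson subsetD)

lemma contains_C5_mono: "contains_C5 V' E' \<Longrightarrow> V' \<subseteq> V \<Longrightarrow> E' \<subseteq> E \<Longrightarrow> contains_C5 V E"
  unfolding contains_C5_def by (metis subsetD)

text \<open>\<open>C\<close> is the component of \<open>z\<close> after deleting \<open>b\<close>.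
  The parts are \<open>C\<close> with \<open>b\<close> and the complement of \<open>C\<close>, which
  contains \<open>a\<close> and \<open>b\<close>. They share only \<open>b\<close>, and each edge
  lies inside one of them.\<close>

lemma cut_vertex_split:
  assumes simple: "simple_graph V E" and ab: "{b, a} \<in> E" and zb: "{b, z} \<in> E"
    and cut: "(z, a) \<notin> reach {e \<in> E. b \<notin> e}"
  obtains V1 V2 where "V1 \<subseteq> V" "V2 \<subseteq> V" "card V1 \<ge> 2" "card V2 \<ge> 2" "card V1 + card V2 = card V + 1"
    "card E \<le> card {e \<in> E. e \<subseteq> V1} + card {e \<in> E. e \<subseteq> V2}"
proof -
  have fin: "finite V" and ed: "\<And>e. e \<in> E \<Longrightarrow> e \<subseteq> V \<and> card e = 2"
    using simple by (auto simp: simple_graph_def)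
  have inV: "a \<in> V" "b \<in> V" "z \<in> V" "a \<noteq> b" "z \<noteq> b"
    using ed[OF ab] ed[OF zb] by auto
  define C where "C = {v \<in> V - {b}. (z, v) \<in> reach {e \<in> E. b \<notin> e}}"
  define V1 where "V1 = insert b C"
  define V2 where "V2 = V - C"
  have C: "C \<subseteq> V" "b \<notin> C" "z \<in> C" "a \<notin> C" using cut inV by (auto simp: C_def)
  have finC: "finite C" using C fin finite_subset by blast
  have "card V1 = Suc (card C)" using C finC by (simp add: V1_def)
  moreover have "card V2 = card V - card C" "card C \<le> card V"
    using C finC fin by (simp_all add: V2_def card_Diff_subset card_mono)
  moreover have "card C > 0" using C finC by (auto simp: card_gt_0_iff)
  moreover have "card {a, b} \<le> card V2" using C inV fin by (intro card_mono) (auto simp: V2_def)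
  moreover have "e \<subseteq> V1 \<or> e \<subseteq> V2" if e: "e \<in> E" for e
  proof -
    obtain u v where uv: "e = {u, v}" "u \<in> V" "v \<in> V"
      using ed[OF e] by (auto simp: card_2_iff)
    show ?thesis
    proof (cases "b \<in> e")
      case True
      then show ?thesis using uv C inV by (auto simp: V1_def V2_def)
    next
      case False
      then have "{u, v} \<in> {e \<in> E. b \<notin> e}" using e uv by simp
      then have "(u, v) \<in> reach {e \<in> E. b \<notin> e}" "(v, u) \<in> reach {e \<in> E. b \<notin> e}"
        using reach_edge reach_sym by metis+
      then have "u \<in> C \<longleftrightarrow> v \<in> C"
        using uv False reach_trans[of z] unfolding C_def by blast
      then show ?thesis using uv by (auto simp: V1_def V2_def)
    qed
  qed
  then have "E = {e \<in> E. e \<subseteq> V1} \<union> {e \<in> E. e \<subseteq> V2}" by blast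
  then have "card E \<le> card {e \<in> E. e \<subseteq> V1} + card {e \<in> E. e \<subseteq> V2}"
    using card_Un_le by metis
  ultimately show ?thesis
    using that[of V1 V2] C inV by (simp add: V1_def V2_def)
qed

text \<open>The constant 23 is the largest that a single edge on two vertices permits. At a cut
  vertex, the bounds for the parts add up to \<open>7 * card E + 46 \<le> 15 * (card V + 1)\<close>,
  more than enough. Deleting a vertex of degree at most 2 lowers the left side by at most 14 and the
  right side by 15.\<close>

lemma plane_K4_C5_free_edges:
  assumes "plane_graph V E f \<gamma>" "\<not> contains_K4 V E" "\<not> contains_C5 V E" "card V \<ge> 2"
  shows "7 * card E + 23 \<le> 15 * card V"
  using assms
proof (induction "card V" arbitrary: V E rule: less_induct)
  case less
  interpret plane_graph V E f \<gamma> by (rule less.prems(1))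
  have IH: "7 * card {e \<in> E. e \<subseteq> W} + 23 \<le> 15 * card W"
    if W: "W \<subseteq> V" "card W < card V" "2 \<le> card W" for W
  proof (rule less.hyps)
    show "plane_graph W {e \<in> E. e \<subseteq> W} f \<gamma>"
      by (rule plane_graph_subgraph[OF less.prems(1) W(1)]) auto
    show "\<not> contains_K4 W {e \<in> E. e \<subseteq> W}" "\<not> contains_C5 W {e \<in> E. e \<subseteq> W}"
      using less.prems(2,3) W(1) contains_K4_mono[of W "{e \<in> E. e \<subseteq> W}" V E]
        contains_C5_mono[of W "{e \<in> E. e \<subseteq> W}" V E] by auto
  qed (use W in auto)
  show ?case
  proof (cases "\<forall>b a z. {b, a} \<in> E \<longrightarrow> {b, z} \<in> E \<longrightarrow> (z, a) \<in> reach {e \<in> E. b \<notin> e}")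
    case False
    then obtain b a z where "{b, a} \<in> E" "{b, z} \<in> E" "(z, a) \<notin> reach {e \<in> E. b \<notin> e}"
      by blast
    from cut_vertex_split[OF simple this] obtain V1 V2 where "V1 \<subseteq> V" "V2 \<subseteq> V" "card V1 \<ge> 2" "card V2 \<ge> 2"
      "card V1 + card V2 = card V + 1" "card E \<le> card {e \<in> E. e \<subseteq> V1} + card {e \<in> E. e \<subseteq> V2}"
      by blast
    then show ?thesis using IH[of V1] IH[of V2] by linarith
  next
    case True
    show ?thesis
    proof (cases "card V = 2")
      case True
      then have "E \<subseteq> {V}"
        using edgeD finite_V card_subset_eq by (metis singletonI subsetI)
      then have "card E \<le> 1" using card_mono[of "{V}" E] by simp
      then show ?thesis using True by simp
    next
      case False
      then have n: "card V \<ge> 3" using less.prems(4) by simp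
      show ?thesis
      proof (cases "\<forall>v\<in>V. degree E v \<ge> 3")
        case True
        then show ?thesis
          using locally_2_connected_bound[OF True less.prems(2,3) n]
            \<open>\<forall>b a z. {b, a} \<in> E \<longrightarrow> {b, z} \<in> E \<longrightarrow> (z, a) \<in> reach {e \<in> E. b \<notin> e}\<close> by fastforce
      next
        case False
        then obtain v where v: "v \<in> V" "degree E v \<le> 2" by fastforce
        have c: "card (V - {v}) = card V - 1" using v finite_V by simp
        have "E = {e \<in> E. v \<in> e} \<union> {e \<in> E. e \<subseteq> V - {v}}"
          using edgeD by blast
        then have "card E \<le> degree E v + card {e \<in> E. e \<subseteq> V - {v}}"
          unfolding degree_def using card_Un_le by metis
        moreover have "7 * card {e \<in> E. e \<subseteq> V - {v}} + 23 \<le> 15 * (card V - 1)"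
          using IH[of "V - {v}"] c n by auto
        ultimately show ?thesis using v(2) n by linarith
      qed
    qed
  qed
qed

theorem theorem1:
  fixes V :: "'a set" and E :: "'a set set"
  assumes "simple_graph V E"
    and "planar V E"
    and "card V \<ge> 5"
    and "\<forall>v\<in>V. degree E v \<ge> 3"
    and "\<not> contains_K4 V E"
    and "\<not> contains_C5 V E"
  shows "real (card E) \<le> 15 / 7 * (real (card V) - 2)"
proof -
  obtain f \<gamma> where "plane_embedding V E f \<gamma>"
    using assms(2) by (auto simp: planar_def)
  then interpret plane_graph V E f \<gamma>
    using assms(1) by unfold_locales
  have "7 * card E + 30 \<le> 15 * card V"
  proof (cases "\<forall>b a z. {b, a} \<in> E \<longrightarrow> {b, z} \<in> E \<longrightarrow> (z, a) \<in> reach {e \<in> E. b \<notin> e}")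
    case True
    then show ?thesis
      using locally_2_connected_bound[OF assms(4-6)] assms(3) by fastforce
  next
    case False
    then obtain b a z where "{b, a} \<in> E" "{b, z} \<in> E" "(z, a) \<notin> reach {e \<in> E. b \<notin> e}"
      by blast
    from cut_vertex_split[OF assms(1) this] obtain V1 V2 where V12: "V1 \<subseteq> V" "V2 \<subseteq> V" "card V1 \<ge> 2" "card V2 \<ge> 2"
      "card V1 + card V2 = card V + 1" "card E \<le> card {e \<in> E. e \<subseteq> V1} + card {e \<in> E. e \<subseteq> V2}"
      by blast
    \<comment> \<open>Inside a part \<open>b\<close> may have degree below 3, so the bound without a
      degree condition is used.\<close>
    have "7 * card {e \<in> E. e \<subseteq> W} + 23 \<le> 15 * card W" if W: "W \<subseteq> V" "2 \<le> card W" for W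
    proof (rule plane_K4_C5_free_edges)
      show "plane_graph W {e \<in> E. e \<subseteq> W} f \<gamma>"
        by (rule plane_graph_subgraph[OF plane_graph_axioms W(1)]) auto
      show "\<not> contains_K4 W {e \<in> E. e \<subseteq> W}" "\<not> contains_C5 W {e \<in> E. e \<subseteq> W}"
        using assms(5,6) W(1) contains_K4_mono[of W "{e \<in> E. e \<subseteq> W}" V E]
          contains_C5_mono[of W "{e \<in> E. e \<subseteq> W}" V E] by auto
    qed (rule W(2))
    \<comment> \<open>The parts have \<open>card V + 1\<close> vertices in total, so the sum reads
      \<open>7 * card E + 46 \<le> 15 * card V + 15\<close>, which is stronger than the claim by
      one.\<close>
    from this[OF V12(1,3)] this[OF V12(2,4)] show ?thesis using V12(5,6) by linarith
  qed
  then have "7 * real (card E) + 30 \<le> 15 * real (card V)" by linarith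
  then show ?thesis by (simp add: field_simps)
qed

end
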